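(* Let $\mathbb{K}$ be an integral domain, let $G$ be a group which has at least one non-normal finite cyclic subgroup $\langle a\rangle$ and let $b\in G\setminus\mathfrak{N}_G(\langle a\rangle)$. Let $M$ be the smallest integer with the properties that $2\leq M\leq |a|$ and $b\in\mathfrak{N}_G(\langle a^{M}\rangle)$. For an integer $k$ with $1\leq k\leq |a|$, the element $\mathfrak{u}_k=a^k+(a-1)b\widehat{a}$ is a unit in $\mathbb{K}G$ and the following hold: (i) if $(k,|a|)=1$, then $\mathfrak{u}_k$ has finite order $|a|$; (ii) if $(k,|a|)\neq 1$, then $\mathfrak{u}_k$ has finite order $\frac{|a|}{(k,|a|)}$ if $(k,M)=1$ and $M\neq |a|$; otherwise it has infinite order.
   Context: $\mathbb{K}G$ is the group ring of $G$ over $\mathbb{K}$. $\mathfrak{N}_G(H)$ is the normalizer of the subgroup $H$ in $G$. For $a\in G$ of finite order $|a|$, $\widehat{a}=\sum_{i=1}^{|a|}a^i$. $(k,l)$ denotes the greatest common divisor of $k$ and $l$.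
   Formalization: The infinite-order claim in (ii) is proved only for K of characteristic zero; in characteristic p>0 it is always false (e.g. K=F_2, G=S_3, a a transposition, b a 3-cycle, k=2, where KG is finite). *)

theory Defs
  imports "HOL-Algebra.Algebra"
begin

text \<open>
  Elements of the group ring are functions of finite support on the whole type, equal to
  zero outside the carrier of the group.  The convolution is summed over the support
  of the left factor, because \<^const>\<open>finsum\<close> ignores sums over infinite index sets.
\<close>

definition group_ring ::
  "('k, 'm) ring_scheme \<Rightarrow> ('g, 'n) monoid_scheme \<Rightarrow> ('g \<Rightarrow> 'k) ring"
  where "group_ring K G =
    \<lparr>carrier = {f. (\<forall>x \<in> carrier G. f x \<in> carrier K) \<and> (\<forall>x. x \<notin> carrier G \<longrightarrow> f x = \<zero>\<^bsub>K\<^esub>) \<and>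
                   finite {x. f x \<noteq> \<zero>\<^bsub>K\<^esub>}},
     monoid.mult = (\<lambda>f g x. if x \<in> carrier G
               then (\<Oplus>\<^bsub>K\<^esub>y \<in> {y. f y \<noteq> \<zero>\<^bsub>K\<^esub>}. f y \<otimes>\<^bsub>K\<^esub> g (inv\<^bsub>G\<^esub> y \<otimes>\<^bsub>G\<^esub> x)) else \<zero>\<^bsub>K\<^esub>),
     monoid.one = (\<lambda>x. if x = \<one>\<^bsub>G\<^esub> then \<one>\<^bsub>K\<^esub> else \<zero>\<^bsub>K\<^esub>),
     ring.zero = (\<lambda>x. \<zero>\<^bsub>K\<^esub>),
     ring.add = (\<lambda>f g x. f x \<oplus>\<^bsub>K\<^esub> g x)\<rparr>"

definition gr_of :: "('k, 'm) ring_scheme \<Rightarrow> 'g \<Rightarrow> 'g \<Rightarrow> 'k"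
  where "gr_of K g = (\<lambda>x. if x = g then \<one>\<^bsub>K\<^esub> else \<zero>\<^bsub>K\<^esub>)"

definition gr_hat :: "('k, 'm) ring_scheme \<Rightarrow> ('g, 'n) monoid_scheme \<Rightarrow> 'g \<Rightarrow> 'g \<Rightarrow> 'k"
  where "gr_hat K G a = (\<Oplus>\<^bsub>group_ring K G\<^esub>i \<in> {1..group.ord G a}. gr_of K (a [^]\<^bsub>G\<^esub> i))"

definition gr_u ::
  "('k, 'm) ring_scheme \<Rightarrow> ('g, 'n) monoid_scheme \<Rightarrow> 'g \<Rightarrow> 'g \<Rightarrow> nat \<Rightarrow> 'g \<Rightarrow> 'k"
  where "gr_u K G a b k =
    gr_of K (a [^]\<^bsub>G\<^esub> k) \<oplus>\<^bsub>group_ring K G\<^esub>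
      (gr_of K a \<ominus>\<^bsub>group_ring K G\<^esub> \<one>\<^bsub>group_ring K G\<^esub>)
        \<otimes>\<^bsub>group_ring K G\<^esub> gr_of K b \<otimes>\<^bsub>group_ring K G\<^esub> gr_hat K G a"

text \<open>
  A unit \<open>1 + x\<close> with \<open>x\<^sup>2 = 0\<close> has order dividing \<open>p\<close> in characteristic \<open>p > 0\<close>, so the elements
  \<open>gr_u K G a b k\<close> can have infinite order only in characteristic zero.
\<close>

definition char_zero :: "('k, 'm) ring_scheme \<Rightarrow> bool"
  where "char_zero K \<longleftrightarrow> (\<forall>m::nat. m > 0 \<longrightarrow> [m] \<cdot>\<^bsub>K\<^esub> \<one>\<^bsub>K\<^esub> \<noteq> \<zero>\<^bsub>K\<^esub>)"

text \<open>
  \<^term>\<open>group_ring K G\<close> is a ring, so \<^term>\<open>units_of (group_ring K G)\<close> is a group and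
  \<^const>\<open>group.ord\<close> in it is the usual order, with value 0 for infinite order.
\<close>

context
  fixes K :: "('k, 'm) ring_scheme" (structure)
    and G :: "('g, 'n) monoid_scheme"
  assumes K: "cring K" and G: "group G"
begin

interpretation K: cring K by (rule K)
interpretation G: group G by (rule G)

lemma group_ring_carrierD:
  assumes "f \<in> carrier (group_ring K G)"
  shows "f x \<in> carrier K" "finite {x. f x \<noteq> \<zero>}" "{x. f x \<noteq> \<zero>} \<subseteq> carrier G"
    "x \<notin> carrier G \<Longrightarrow> f x = \<zero>"
  using assms by (cases "x \<in> carrier G"; auto simp: group_ring_def)+

lemma group_ring_carrierI:
  assumes "\<And>x. x \<in> carrier G \<Longrightarrow> f x \<in> carrier K" "\<And>x. x \<notin> carrier G \<Longrightarrow> f x = \<zero>"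
    "finite S" "\<And>x. x \<in> carrier G \<Longrightarrow> x \<notin> S \<Longrightarrow> f x = \<zero>"
  shows "f \<in> carrier (group_ring K G)"
proof -
  have "{x. f x \<noteq> \<zero>} \<subseteq> S" using assms by blast
  then show ?thesis using assms finite_subset by (auto simp: group_ring_def)
qed

lemma group_ring_mult_superset:
  assumes f: "f \<in> carrier (group_ring K G)" and g: "g \<in> carrier (group_ring K G)"
    and S: "finite S" "{y. f y \<noteq> \<zero>} \<subseteq> S" and x: "x \<in> carrier G"
  shows "(f \<otimes>\<^bsub>group_ring K G\<^esub> g) x = (\<Oplus>y\<in>S. f y \<otimes> g (inv\<^bsub>G\<^esub> y \<otimes>\<^bsub>G\<^esub> x))"
proof -
  note [simp] = group_ring_carrierD(1)[OF f] group_ring_carrierD(1)[OF g]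
  have "(\<Oplus>y\<in>{y. f y \<noteq> \<zero>}. f y \<otimes> g (inv\<^bsub>G\<^esub> y \<otimes>\<^bsub>G\<^esub> x)) = (\<Oplus>y\<in>S. f y \<otimes> g (inv\<^bsub>G\<^esub> y \<otimes>\<^bsub>G\<^esub> x))"
    by (rule K.add.finprod_mono_neutral_cong_left) (use S in auto)
  then show ?thesis using x by (simp add: group_ring_def)
qed

lemma group_ring_mult_outside:
  "x \<notin> carrier G \<Longrightarrow> (f \<otimes>\<^bsub>group_ring K G\<^esub> g) x = \<zero>"
  by (simp add: group_ring_def)

lemma group_ring_mult_closed:
  assumes f: "f \<in> carrier (group_ring K G)" and g: "g \<in> carrier (group_ring K G)"
  shows "f \<otimes>\<^bsub>group_ring K G\<^esub> g \<in> carrier (group_ring K G)"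
    and "{x. (f \<otimes>\<^bsub>group_ring K G\<^esub> g) x \<noteq> \<zero>} \<subseteq>
      (\<lambda>(y, z). y \<otimes>\<^bsub>G\<^esub> z) ` ({y. f y \<noteq> \<zero>} \<times> {z. g z \<noteq> \<zero>})" (is "_ \<subseteq> ?T")
proof -
  let ?S = "{y. f y \<noteq> \<zero>}"
  note [simp] = group_ring_carrierD(1)[OF f] group_ring_carrierD(1)[OF g]
  note fin = group_ring_carrierD(2)[OF f] group_ring_carrierD(2)[OF g]
  have e: "(f \<otimes>\<^bsub>group_ring K G\<^esub> g) x = (\<Oplus>y\<in>?S. f y \<otimes> g (inv\<^bsub>G\<^esub> y \<otimes>\<^bsub>G\<^esub> x))"
    if "x \<in> carrier G" for x
    by (rule group_ring_mult_superset[OF f g]) (use that fin in auto)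
  have z: "(f \<otimes>\<^bsub>group_ring K G\<^esub> g) x = \<zero>" if x: "x \<in> carrier G" "x \<notin> ?T" for x
  proof -
    have "g (inv\<^bsub>G\<^esub> y \<otimes>\<^bsub>G\<^esub> x) = \<zero>" if y: "y \<in> ?S" for y
    proof (rule ccontr)
      assume "g (inv\<^bsub>G\<^esub> y \<otimes>\<^bsub>G\<^esub> x) \<noteq> \<zero>"
      moreover have "y \<in> carrier G" using y group_ring_carrierD(3)[OF f] by blast
      then have "y \<otimes>\<^bsub>G\<^esub> (inv\<^bsub>G\<^esub> y \<otimes>\<^bsub>G\<^esub> x) = x"
        using x(1) by (simp add: G.m_assoc[symmetric])
      ultimately have "x \<in> ?T"
        using y by (intro image_eqI[of _ _ "(y, inv\<^bsub>G\<^esub> y \<otimes>\<^bsub>G\<^esub> x)"]) auto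
      then show False using x by blast
    qed
    then have "(\<Oplus>y\<in>?S. f y \<otimes> g (inv\<^bsub>G\<^esub> y \<otimes>\<^bsub>G\<^esub> x)) = \<zero>"
      by (intro K.add.finprod_one_eqI) simp
    then show ?thesis using e x by simp
  qed
  show "f \<otimes>\<^bsub>group_ring K G\<^esub> g \<in> carrier (group_ring K G)"
  proof (rule group_ring_carrierI[where S = ?T])
    show "finite ?T" using fin by auto
  qed (use e z group_ring_mult_outside in auto)
  show "{x. (f \<otimes>\<^bsub>group_ring K G\<^esub> g) x \<noteq> \<zero>} \<subseteq> ?T"
    using z group_ring_mult_outside by blast
qed

lemma finsum_swap:
  assumes "finite A" "finite B" "\<And>i j. i \<in> A \<Longrightarrow> j \<in> B \<Longrightarrow> h i j \<in> carrier K"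
  shows "(\<Oplus>i\<in>A. \<Oplus>j\<in>B. h i j) = (\<Oplus>j\<in>B. \<Oplus>i\<in>A. h i j)"
  using assms(1) assms(3)
proof (induction A rule: finite_induct)
  case empty
  then show ?case by simp
next
  case (insert a A)
  have 1: "(\<Oplus>i\<in>insert a A. \<Oplus>j\<in>B. h i j) = (\<Oplus>j\<in>B. h a j) \<oplus> (\<Oplus>j\<in>B. \<Oplus>i\<in>A. h i j)"
    using insert by (subst K.finsum_insert) (auto intro!: K.finsum_closed)
  have 2: "(\<Oplus>i\<in>insert a A. h i j) = h a j \<oplus> (\<Oplus>i\<in>A. h i j)" if "j \<in> B" for j
    using insert that by (subst K.finsum_insert) auto
  have "(\<Oplus>j\<in>B. \<Oplus>i\<in>insert a A. h i j) = (\<Oplus>j\<in>B. h a j \<oplus> (\<Oplus>i\<in>A. h i j))"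
    using insert 2 by (intro K.finsum_cong') (auto intro!: K.finsum_closed)
  also have "\<dots> = (\<Oplus>j\<in>B. h a j) \<oplus> (\<Oplus>j\<in>B. \<Oplus>i\<in>A. h i j)"
    using insert by (intro K.finsum_addf) (auto intro!: K.finsum_closed)
  finally show ?case using 1 by simp
qed

lemma group_ring_assoc:
  assumes f: "f \<in> carrier (group_ring K G)" and g: "g \<in> carrier (group_ring K G)"
    and h: "h \<in> carrier (group_ring K G)"
  shows "f \<otimes>\<^bsub>group_ring K G\<^esub> g \<otimes>\<^bsub>group_ring K G\<^esub> h = f \<otimes>\<^bsub>group_ring K G\<^esub> (g \<otimes>\<^bsub>group_ring K G\<^esub> h)"
    (is "?L = ?R")
proof
  fix x
  let ?S = "{y. f y \<noteq> \<zero>}"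
  let ?T = "(\<lambda>(y, z). y \<otimes>\<^bsub>G\<^esub> z) ` (?S \<times> {z. g z \<noteq> \<zero>})"
  note [simp] = group_ring_carrierD(1)[OF f] group_ring_carrierD(1)[OF g] group_ring_carrierD(1)[OF h]
  note fin = group_ring_carrierD(2)[OF f] group_ring_carrierD(2)[OF g]
  note sub = group_ring_carrierD(3)[OF f] group_ring_carrierD(3)[OF g]
  have T: "finite ?T" using fin by auto
  have TG: "?T \<subseteq> carrier G" using sub by auto
  show "?L x = ?R x"
  proof (cases "x \<in> carrier G")
    case x: True
    have "?L x = (\<Oplus>z\<in>?T. (f \<otimes>\<^bsub>group_ring K G\<^esub> g) z \<otimes> h (inv\<^bsub>G\<^esub> z \<otimes>\<^bsub>G\<^esub> x))"
      by (rule group_ring_mult_superset[OF group_ring_mult_closed(1)[OF f g] h T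
            group_ring_mult_closed(2)[OF f g] x])
    also have "\<dots> = (\<Oplus>z\<in>?T. \<Oplus>y\<in>?S. f y \<otimes> (g (inv\<^bsub>G\<^esub> y \<otimes>\<^bsub>G\<^esub> z) \<otimes> h (inv\<^bsub>G\<^esub> z \<otimes>\<^bsub>G\<^esub> x)))"
    proof (rule K.finsum_cong')
      fix z assume "z \<in> ?T"
      then have z: "z \<in> carrier G" using TG by blast
      have "(f \<otimes>\<^bsub>group_ring K G\<^esub> g) z \<otimes> h (inv\<^bsub>G\<^esub> z \<otimes>\<^bsub>G\<^esub> x) =
          (\<Oplus>y\<in>?S. f y \<otimes> g (inv\<^bsub>G\<^esub> y \<otimes>\<^bsub>G\<^esub> z)) \<otimes> h (inv\<^bsub>G\<^esub> z \<otimes>\<^bsub>G\<^esub> x)"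
        by (subst group_ring_mult_superset[OF f g fin(1) order_refl z]) simp
      also have "\<dots> = (\<Oplus>y\<in>?S. f y \<otimes> g (inv\<^bsub>G\<^esub> y \<otimes>\<^bsub>G\<^esub> z) \<otimes> h (inv\<^bsub>G\<^esub> z \<otimes>\<^bsub>G\<^esub> x))"
        by (rule K.finsum_ldistr) (use fin in auto)
      finally show "(f \<otimes>\<^bsub>group_ring K G\<^esub> g) z \<otimes> h (inv\<^bsub>G\<^esub> z \<otimes>\<^bsub>G\<^esub> x) =
          (\<Oplus>y\<in>?S. f y \<otimes> (g (inv\<^bsub>G\<^esub> y \<otimes>\<^bsub>G\<^esub> z) \<otimes> h (inv\<^bsub>G\<^esub> z \<otimes>\<^bsub>G\<^esub> x)))"
        by (simp add: K.m_assoc)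
    qed (auto intro!: K.finsum_closed)
    also have "\<dots> = (\<Oplus>y\<in>?S. \<Oplus>z\<in>?T. f y \<otimes> (g (inv\<^bsub>G\<^esub> y \<otimes>\<^bsub>G\<^esub> z) \<otimes> h (inv\<^bsub>G\<^esub> z \<otimes>\<^bsub>G\<^esub> x)))"
      by (rule finsum_swap[OF T fin(1)]) simp
    also have "\<dots> = (\<Oplus>y\<in>?S. f y \<otimes> (g \<otimes>\<^bsub>group_ring K G\<^esub> h) (inv\<^bsub>G\<^esub> y \<otimes>\<^bsub>G\<^esub> x))"
    proof (rule K.finsum_cong')
      fix y assume yS: "y \<in> ?S"
      then have y: "y \<in> carrier G" using sub by blast
      let ?W = "(\<lambda>z. inv\<^bsub>G\<^esub> y \<otimes>\<^bsub>G\<^esub> z) ` ?T"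
      have W: "{z. g z \<noteq> \<zero>} \<subseteq> ?W"
      proof
        fix w assume w: "w \<in> {z. g z \<noteq> \<zero>}"
        then have wG: "w \<in> carrier G" using sub by blast
        have "y \<otimes>\<^bsub>G\<^esub> w \<in> ?T" using yS w by (intro image_eqI[of _ _ "(y, w)"]) auto
        moreover have "w = inv\<^bsub>G\<^esub> y \<otimes>\<^bsub>G\<^esub> (y \<otimes>\<^bsub>G\<^esub> w)"
          using y wG by (simp add: G.m_assoc[symmetric])
        ultimately show "w \<in> ?W" by blast
      qed
      have inj: "inj_on (\<lambda>z. inv\<^bsub>G\<^esub> y \<otimes>\<^bsub>G\<^esub> z) ?T"
        by (rule inj_onI) (use y TG in \<open>meson G.inv_closed G.l_cancel subsetD\<close>)
      have "(g \<otimes>\<^bsub>group_ring K G\<^esub> h) (inv\<^bsub>G\<^esub> y \<otimes>\<^bsub>G\<^esub> x) =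
          (\<Oplus>w\<in>?W. g w \<otimes> h (inv\<^bsub>G\<^esub> w \<otimes>\<^bsub>G\<^esub> (inv\<^bsub>G\<^esub> y \<otimes>\<^bsub>G\<^esub> x)))"
        by (rule group_ring_mult_superset[OF g h _ W]) (use T x y in auto)
      also have "\<dots> = (\<Oplus>z\<in>?T. g (inv\<^bsub>G\<^esub> y \<otimes>\<^bsub>G\<^esub> z) \<otimes>
          h (inv\<^bsub>G\<^esub> (inv\<^bsub>G\<^esub> y \<otimes>\<^bsub>G\<^esub> z) \<otimes>\<^bsub>G\<^esub> (inv\<^bsub>G\<^esub> y \<otimes>\<^bsub>G\<^esub> x)))"
        by (rule K.finsum_reindex[OF _ inj]) auto
      also have "\<dots> = (\<Oplus>z\<in>?T. g (inv\<^bsub>G\<^esub> y \<otimes>\<^bsub>G\<^esub> z) \<otimes> h (inv\<^bsub>G\<^esub> z \<otimes>\<^bsub>G\<^esub> x))"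
      proof (rule K.finsum_cong')
        fix z assume "z \<in> ?T"
        then have z: "z \<in> carrier G" using TG by blast
        have "inv\<^bsub>G\<^esub> (inv\<^bsub>G\<^esub> y \<otimes>\<^bsub>G\<^esub> z) \<otimes>\<^bsub>G\<^esub> (inv\<^bsub>G\<^esub> y \<otimes>\<^bsub>G\<^esub> x) =
            inv\<^bsub>G\<^esub> z \<otimes>\<^bsub>G\<^esub> (y \<otimes>\<^bsub>G\<^esub> (inv\<^bsub>G\<^esub> y \<otimes>\<^bsub>G\<^esub> x))"
          using x y z by (simp add: G.inv_mult_group G.m_assoc)
        also have "y \<otimes>\<^bsub>G\<^esub> (inv\<^bsub>G\<^esub> y \<otimes>\<^bsub>G\<^esub> x) = x"
          using x y by (simp add: G.m_assoc[symmetric])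
        finally show "g (inv\<^bsub>G\<^esub> y \<otimes>\<^bsub>G\<^esub> z) \<otimes>
            h (inv\<^bsub>G\<^esub> (inv\<^bsub>G\<^esub> y \<otimes>\<^bsub>G\<^esub> z) \<otimes>\<^bsub>G\<^esub> (inv\<^bsub>G\<^esub> y \<otimes>\<^bsub>G\<^esub> x)) =
            g (inv\<^bsub>G\<^esub> y \<otimes>\<^bsub>G\<^esub> z) \<otimes> h (inv\<^bsub>G\<^esub> z \<otimes>\<^bsub>G\<^esub> x)" by simp
      qed auto
      finally have "f y \<otimes> (g \<otimes>\<^bsub>group_ring K G\<^esub> h) (inv\<^bsub>G\<^esub> y \<otimes>\<^bsub>G\<^esub> x) =
          f y \<otimes> (\<Oplus>z\<in>?T. g (inv\<^bsub>G\<^esub> y \<otimes>\<^bsub>G\<^esub> z) \<otimes> h (inv\<^bsub>G\<^esub> z \<otimes>\<^bsub>G\<^esub> x))" by simp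
      also have "\<dots> = (\<Oplus>z\<in>?T. f y \<otimes> (g (inv\<^bsub>G\<^esub> y \<otimes>\<^bsub>G\<^esub> z) \<otimes> h (inv\<^bsub>G\<^esub> z \<otimes>\<^bsub>G\<^esub> x)))"
        by (rule K.finsum_rdistr[OF T]) auto
      finally show "(\<Oplus>z\<in>?T. f y \<otimes> (g (inv\<^bsub>G\<^esub> y \<otimes>\<^bsub>G\<^esub> z) \<otimes> h (inv\<^bsub>G\<^esub> z \<otimes>\<^bsub>G\<^esub> x))) =
          f y \<otimes> (g \<otimes>\<^bsub>group_ring K G\<^esub> h) (inv\<^bsub>G\<^esub> y \<otimes>\<^bsub>G\<^esub> x)" by simp
    qed (auto intro!: K.m_closed group_ring_carrierD(1)[OF group_ring_mult_closed(1)[OF g h]])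
    also have "\<dots> = ?R x"
      by (rule group_ring_mult_superset[OF f group_ring_mult_closed(1)[OF g h] fin(1) order_refl x,
            symmetric])
    finally show ?thesis .
  qed (simp add: group_ring_mult_outside)
qed

lemma gr_of_closed:
  "g \<in> carrier G \<Longrightarrow> gr_of K g \<in> carrier (group_ring K G)"
  by (rule group_ring_carrierI[where S = "{g}"]) (auto simp: gr_of_def)

lemma group_ring_one: "\<one>\<^bsub>group_ring K G\<^esub> = gr_of K \<one>\<^bsub>G\<^esub>"
  by (simp add: group_ring_def gr_of_def)

lemma gr_of_mult_left:
  assumes "g \<in> carrier G" "f \<in> carrier (group_ring K G)" "x \<in> carrier G"
  shows "(gr_of K g \<otimes>\<^bsub>group_ring K G\<^esub> f) x = f (inv\<^bsub>G\<^esub> g \<otimes>\<^bsub>G\<^esub> x)"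
proof -
  note [simp] = group_ring_carrierD(1)[OF assms(2)]
  have "(gr_of K g \<otimes>\<^bsub>group_ring K G\<^esub> f) x =
      (\<Oplus>y\<in>{g}. gr_of K g y \<otimes> f (inv\<^bsub>G\<^esub> y \<otimes>\<^bsub>G\<^esub> x))"
    by (rule group_ring_mult_superset) (use assms gr_of_closed in \<open>auto simp: gr_of_def\<close>)
  also have "\<dots> = f (inv\<^bsub>G\<^esub> g \<otimes>\<^bsub>G\<^esub> x)"
    by (subst K.finsum_insert) (auto simp: gr_of_def)
  finally show ?thesis .
qed

lemma gr_of_mult_right:
  assumes g: "g \<in> carrier G" and f: "f \<in> carrier (group_ring K G)" and x: "x \<in> carrier G"
  shows "(f \<otimes>\<^bsub>group_ring K G\<^esub> gr_of K g) x = f (x \<otimes>\<^bsub>G\<^esub> inv\<^bsub>G\<^esub> g)"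
proof -
  let ?y = "x \<otimes>\<^bsub>G\<^esub> inv\<^bsub>G\<^esub> g"
  let ?S = "{y. f y \<noteq> \<zero>}"
  note [simp] = group_ring_carrierD(1)[OF f] group_ring_carrierD(1)[OF gr_of_closed[OF g]]
  have "(f \<otimes>\<^bsub>group_ring K G\<^esub> gr_of K g) x =
      (\<Oplus>y\<in>insert ?y ?S. f y \<otimes> gr_of K g (inv\<^bsub>G\<^esub> y \<otimes>\<^bsub>G\<^esub> x))"
    by (rule group_ring_mult_superset[OF f gr_of_closed[OF g]])
      (use x group_ring_carrierD(2)[OF f] in auto)
  also have "\<dots> = (\<Oplus>y\<in>insert ?y ?S. if ?y = y then f y else \<zero>)"
  proof (rule K.finsum_cong')
    fix y assume "y \<in> insert ?y ?S"
    then have y: "y \<in> carrier G" using g x group_ring_carrierD(3)[OF f] by auto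
    then have "inv\<^bsub>G\<^esub> y \<otimes>\<^bsub>G\<^esub> x = g \<longleftrightarrow> ?y = y"
      by (metis G.inv_closed G.inv_solve_left G.inv_solve_right g x)
    then show "f y \<otimes> gr_of K g (inv\<^bsub>G\<^esub> y \<otimes>\<^bsub>G\<^esub> x) = (if ?y = y then f y else \<zero>)"
      by (auto simp: gr_of_def)
  qed auto
  also have "\<dots> = f ?y"
    by (rule K.finsum_singleton) (use group_ring_carrierD(2)[OF f] in auto)
  finally show ?thesis .
qed

lemma group_ring_ring: "ring (group_ring K G)"
proof (rule ringI)
  let ?R = "group_ring K G"
  have add: "(f \<oplus>\<^bsub>?R\<^esub> g) x = f x \<oplus> g x" for f g x by (simp add: group_ring_def)
  have zero: "\<zero>\<^bsub>?R\<^esub> x = \<zero>" for x by (simp add: group_ring_def)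
  have addc: "f \<oplus>\<^bsub>?R\<^esub> g \<in> carrier ?R" if f: "f \<in> carrier ?R" and g: "g \<in> carrier ?R" for f g
    by (rule group_ring_carrierI[where S = "{x. f x \<noteq> \<zero>} \<union> {x. g x \<noteq> \<zero>}"])
      (use group_ring_carrierD[OF f] group_ring_carrierD[OF g] in \<open>auto simp: add\<close>)
  show "abelian_group ?R"
  proof (rule abelian_groupI)
    show "\<zero>\<^bsub>?R\<^esub> \<in> carrier ?R"
      by (rule group_ring_carrierI[where S = "{}"]) (auto simp: zero)
    fix f assume f: "f \<in> carrier ?R"
    note [simp] = group_ring_carrierD(1)[OF f]
    show "\<zero>\<^bsub>?R\<^esub> \<oplus>\<^bsub>?R\<^esub> f = f" by (rule ext) (simp add: add zero)
    show "\<exists>g \<in> carrier ?R. g \<oplus>\<^bsub>?R\<^esub> f = \<zero>\<^bsub>?R\<^esub>"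
    proof
      show "(\<lambda>x. \<ominus> f x) \<oplus>\<^bsub>?R\<^esub> f = \<zero>\<^bsub>?R\<^esub>"
        by (rule ext) (simp add: add zero K.l_neg)
      show "(\<lambda>x. \<ominus> f x) \<in> carrier ?R"
        by (rule group_ring_carrierI[where S = "{x. f x \<noteq> \<zero>}"])
          (use group_ring_carrierD[OF f] in auto)
    qed
    fix g assume g: "g \<in> carrier ?R"
    note [simp] = group_ring_carrierD(1)[OF g]
    show "f \<oplus>\<^bsub>?R\<^esub> g \<in> carrier ?R" by (rule addc[OF f g])
    show "f \<oplus>\<^bsub>?R\<^esub> g = g \<oplus>\<^bsub>?R\<^esub> f" by (rule ext) (simp add: add K.a_comm)
    fix h assume h: "h \<in> carrier ?R"
    note [simp] = group_ring_carrierD(1)[OF h]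
    show "f \<oplus>\<^bsub>?R\<^esub> g \<oplus>\<^bsub>?R\<^esub> h = f \<oplus>\<^bsub>?R\<^esub> (g \<oplus>\<^bsub>?R\<^esub> h)"
      by (rule ext) (simp add: add K.a_assoc)
  qed
  have one: "\<one>\<^bsub>?R\<^esub> \<in> carrier ?R" by (simp add: group_ring_one gr_of_closed)
  show "monoid ?R"
  proof (rule monoidI)
    fix f assume f: "f \<in> carrier ?R"
    show "\<one>\<^bsub>?R\<^esub> \<otimes>\<^bsub>?R\<^esub> f = f"
    proof
      fix x show "(\<one>\<^bsub>?R\<^esub> \<otimes>\<^bsub>?R\<^esub> f) x = f x"
        by (cases "x \<in> carrier G")
          (simp_all add: group_ring_one gr_of_mult_left f group_ring_mult_outside
            group_ring_carrierD(4)[OF f])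
    qed
    show "f \<otimes>\<^bsub>?R\<^esub> \<one>\<^bsub>?R\<^esub> = f"
    proof
      fix x show "(f \<otimes>\<^bsub>?R\<^esub> \<one>\<^bsub>?R\<^esub>) x = f x"
        by (cases "x \<in> carrier G")
          (simp_all add: group_ring_one gr_of_mult_right f group_ring_mult_outside
            group_ring_carrierD(4)[OF f])
    qed
  qed (use one group_ring_mult_closed(1) group_ring_assoc in auto)
  fix f g h assume f: "f \<in> carrier ?R" and g: "g \<in> carrier ?R" and h: "h \<in> carrier ?R"
  note [simp] = group_ring_carrierD(1)[OF f] group_ring_carrierD(1)[OF g] group_ring_carrierD(1)[OF h]
  let ?S = "{x. f x \<noteq> \<zero>} \<union> {x. g x \<noteq> \<zero>} \<union> {x. h x \<noteq> \<zero>}"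
  have S: "finite ?S" using group_ring_carrierD(2)[OF f] group_ring_carrierD(2)[OF g]
      group_ring_carrierD(2)[OF h] by simp
  have m: "(p \<otimes>\<^bsub>?R\<^esub> q) x = (\<Oplus>y\<in>?S. p y \<otimes> q (inv\<^bsub>G\<^esub> y \<otimes>\<^bsub>G\<^esub> x))"
    if "p \<in> carrier ?R" "q \<in> carrier ?R" "x \<in> carrier G" "{y. p y \<noteq> \<zero>} \<subseteq> ?S" for p q x
    by (rule group_ring_mult_superset) (use S that in auto)
  have fg: "{x. (f \<oplus>\<^bsub>?R\<^esub> g) x \<noteq> \<zero>} \<subseteq> ?S" by (auto simp: add)
  show "(f \<oplus>\<^bsub>?R\<^esub> g) \<otimes>\<^bsub>?R\<^esub> h = f \<otimes>\<^bsub>?R\<^esub> h \<oplus>\<^bsub>?R\<^esub> g \<otimes>\<^bsub>?R\<^esub> h"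
  proof
    fix x
    show "((f \<oplus>\<^bsub>?R\<^esub> g) \<otimes>\<^bsub>?R\<^esub> h) x = (f \<otimes>\<^bsub>?R\<^esub> h \<oplus>\<^bsub>?R\<^esub> g \<otimes>\<^bsub>?R\<^esub> h) x"
    proof (cases "x \<in> carrier G")
      case True
      have "((f \<oplus>\<^bsub>?R\<^esub> g) \<otimes>\<^bsub>?R\<^esub> h) x =
          (\<Oplus>y\<in>?S. f y \<otimes> h (inv\<^bsub>G\<^esub> y \<otimes>\<^bsub>G\<^esub> x) \<oplus> g y \<otimes> h (inv\<^bsub>G\<^esub> y \<otimes>\<^bsub>G\<^esub> x))"
        unfolding m[OF addc[OF f g] h True fg]
        by (simp add: add K.l_distr)
      also have "\<dots> = (f \<otimes>\<^bsub>?R\<^esub> h) x \<oplus> (g \<otimes>\<^bsub>?R\<^esub> h) x"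
        by (subst m[OF f h True], force, subst m[OF g h True], force, rule K.finsum_addf) auto
      finally show ?thesis by (simp add: add)
    qed (simp add: add group_ring_mult_outside)
  qed
  show "h \<otimes>\<^bsub>?R\<^esub> (f \<oplus>\<^bsub>?R\<^esub> g) = h \<otimes>\<^bsub>?R\<^esub> f \<oplus>\<^bsub>?R\<^esub> h \<otimes>\<^bsub>?R\<^esub> g"
  proof
    fix x
    show "(h \<otimes>\<^bsub>?R\<^esub> (f \<oplus>\<^bsub>?R\<^esub> g)) x = (h \<otimes>\<^bsub>?R\<^esub> f \<oplus>\<^bsub>?R\<^esub> h \<otimes>\<^bsub>?R\<^esub> g) x"
    proof (cases "x \<in> carrier G")
      case True
      have "(h \<otimes>\<^bsub>?R\<^esub> (f \<oplus>\<^bsub>?R\<^esub> g)) x =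
          (\<Oplus>y\<in>?S. h y \<otimes> f (inv\<^bsub>G\<^esub> y \<otimes>\<^bsub>G\<^esub> x) \<oplus> h y \<otimes> g (inv\<^bsub>G\<^esub> y \<otimes>\<^bsub>G\<^esub> x))"
        by (subst m[OF h addc[OF f g] True], force) (simp add: add K.r_distr)
      also have "\<dots> = (h \<otimes>\<^bsub>?R\<^esub> f) x \<oplus> (h \<otimes>\<^bsub>?R\<^esub> g) x"
        by (subst m[OF h f True], force, subst m[OF h g True], force, rule K.finsum_addf) auto
      finally show ?thesis by (simp add: add)
    qed (simp add: add group_ring_mult_outside)
  qed
qed

end

end

theory Submission
  imports Defs
begin

text \<open>
  Put \<open>w = (a - 1) b \<close>\<^term>\<open>gr_hat K G a\<close>. Since \<open>w a = w\<close> and \<open>w\<^sup>2 = 0\<close>, the element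
  \<open>u = a\<^sup>k + w\<close> is a unit with
  \<open>u\<^sup>m = a\<^sup>k\<^sup>m + (\<Sum>i<m. a\<^sup>k\<^sup>i) w\<close>. The second summand is supported on
  \<open>\<langle>a\<rangle> b \<langle>a\<rangle>\<close>, which is disjoint from \<open>\<langle>a\<rangle>\<close>, so \<open>u\<^sup>m = 1\<close> means that \<open>a\<^sup>k\<^sup>m = 1\<close> and that
  the second summand vanishes. Its coefficients are differences of two numbers of indices
  \<open>i < m\<close> for which \<open>k i + 1\<close>, respectively \<open>k i\<close>, lies in a set of integers periodic modulo the
  length \<open>M\<close> of the orbit of the coset \<open>b \<langle>a\<rangle>\<close> under translation by \<open>a\<close>: indeed
  \<open>b\<close> normalizes \<open>\<langle>a\<^sup>m\<rangle>\<close> iff \<open>b\<^sup>-\<^sup>1 a\<^sup>m b \<in> \<langle>a\<rangle>\<close> iff \<open>M\<close> divides \<open>m\<close>. If \<open>k\<close> is coprime to \<open>M\<close>,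
  the two numbers agree by a cyclic shift of the indices. Otherwise, at \<open>b\<close>, the first is zero
  and the second is not.
\<close>

section \<open>Normalizers of finite cyclic subgroups\<close>

lemma (in group) inv_mult_cancel_left:
  assumes "x \<in> carrier G" "y \<in> carrier G"
  shows "inv x \<otimes> (x \<otimes> y) = y" "x \<otimes> (inv x \<otimes> y) = y"
  using assms by (simp_all add: m_assoc[symmetric])

lemma (in group) conj_mult:
  assumes "b \<in> carrier G" "x \<in> carrier G" "y \<in> carrier G"
  shows "inv b \<otimes> (x \<otimes> y) \<otimes> b = (inv b \<otimes> x \<otimes> b) \<otimes> (inv b \<otimes> y \<otimes> b)"
  using assms by (simp add: m_assoc inv_mult_cancel_left)

lemma (in group) conj_inv:
  assumes "b \<in> carrier G" "x \<in> carrier G"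
  shows "inv (inv b \<otimes> x \<otimes> b) = inv b \<otimes> inv x \<otimes> b"
  using assms by (simp add: inv_mult_group m_assoc)

lemma (in group) conj_nat_pow:
  assumes "b \<in> carrier G" "x \<in> carrier G"
  shows "inv b \<otimes> x [^] (n::nat) \<otimes> b = (inv b \<otimes> x \<otimes> b) [^] n"
proof (induction n)
  case (Suc n)
  then show ?case using assms conj_mult[of b "x [^] n" x] by simp
qed (use assms in simp)

text \<open>Conjugation is injective, so on a finite \<open>H\<close> a conjugation map into
  \<open>H\<close> is already onto \<open>H\<close>. Finiteness thus reduces the set equality in the
  definition of the normalizer to one inclusion.\<close>

lemma (in group) mem_normalizer_finite_iff:
  assumes H: "H \<subseteq> carrier G" "finite H" and b: "b \<in> carrier G"
  shows "b \<in> normalizer G H \<longleftrightarrow> (\<forall>h\<in>H. inv b \<otimes> h \<otimes> b \<in> H)"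
proof -
  have N: "b \<in> normalizer G H \<longleftrightarrow> b <#\<^bsub>G\<^esub> H #> inv b = H"
    using H b by (auto simp: normalizer_def stabilizer_def)
  have C: "b <#\<^bsub>G\<^esub> H #> inv b = (\<lambda>h. b \<otimes> h \<otimes> inv b) ` H"
    by (auto simp: l_coset_def r_coset_def)
  have 1: "inv b \<otimes> (b \<otimes> h \<otimes> inv b) \<otimes> b = h" "b \<otimes> (inv b \<otimes> h \<otimes> b) \<otimes> inv b = h" if "h \<in> H" for h
    using that H b by (auto simp: m_assoc inv_mult_cancel_left subset_iff)
  show ?thesis
  proof
    assume "b \<in> normalizer G H"
    then have e: "(\<lambda>h. b \<otimes> h \<otimes> inv b) ` H = H" using N C by simp
    show "\<forall>h\<in>H. inv b \<otimes> h \<otimes> b \<in> H"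
    proof
      fix h assume "h \<in> H"
      then obtain h' where "h' \<in> H" "h = b \<otimes> h' \<otimes> inv b" using e by blast
      then show "inv b \<otimes> h \<otimes> b \<in> H" using 1 by simp
    qed
  next
    assume *: "\<forall>h\<in>H. inv b \<otimes> h \<otimes> b \<in> H"
    have "(\<lambda>h. inv b \<otimes> h \<otimes> b) ` H = H"
    proof (rule endo_inj_surj)
      show "inj_on (\<lambda>h. inv b \<otimes> h \<otimes> b) H"
        by (rule inj_on_inverseI[where g = "\<lambda>h. b \<otimes> h \<otimes> inv b"]) (use 1 in simp)
    qed (use H * in auto)
    then have "(\<lambda>h. b \<otimes> h \<otimes> inv b) ` H = (\<lambda>h. b \<otimes> h \<otimes> inv b) ` (\<lambda>h. inv b \<otimes> h \<otimes> b) ` H"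
      by simp
    also have "\<dots> = H" unfolding image_image using 1 by simp
    finally have "(\<lambda>h. b \<otimes> h \<otimes> inv b) ` H = H" .
    then show "b \<in> normalizer G H" using N C by simp
  qed
qed

lemma (in group) ord_conj:
  assumes "b \<in> carrier G" "x \<in> carrier G"
  shows "ord (inv b \<otimes> x \<otimes> b) = ord x"
proof (rule iffD2[OF ord_unique])
  show "inv b \<otimes> x \<otimes> b \<in> carrier G" using assms by simp
  have "inv b \<otimes> y \<otimes> b = \<one> \<longleftrightarrow> y = \<one>" if y: "y \<in> carrier G" for y
  proof
    have "b \<otimes> (inv b \<otimes> y \<otimes> b) \<otimes> inv b = y"
      using assms y by (simp add: m_assoc inv_mult_cancel_left)
    then show "y = \<one>" if "inv b \<otimes> y \<otimes> b = \<one>"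
      using assms(1) that by simp
  qed (use assms in simp)
  then show "\<forall>n. (inv b \<otimes> x \<otimes> b) [^] n = \<one> \<longleftrightarrow> ord x dvd n"
    using assms by (simp flip: conj_nat_pow pow_eq_id)
qed

text \<open>This trades a condition on the varying subgroup generated by \<open>a [^] m\<close> for
  membership in one fixed subgroup, so that the admissible exponents become closed under addition
  and negation.\<close>

lemma (in group) mem_normalizer_generate_pow_iff:
  assumes a: "a \<in> carrier G" "finite (generate G {a})" and b: "b \<in> carrier G"
  shows "b \<in> normalizer G (generate G {a [^] (m::nat)}) \<longleftrightarrow>
    inv b \<otimes> a [^] m \<otimes> b \<in> generate G {a}"
proof -
  let ?A = "generate G {a}" and ?H = "generate G {a [^] m}"
  have A: "subgroup ?A G" and H: "subgroup ?H G" using a by (auto intro: generate_is_subgroup)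
  have m: "a [^] m \<in> ?H" by (simp add: generate.incl)
  have "a [^] m \<in> ?A"
    by (metis A generate.incl int_pow_int singletonI subgroup_int_pow_closed)
  then have HA: "?H \<subseteq> ?A" using A generate_subgroup_incl by auto
  then have fH: "finite ?H" using a finite_subset by blast
  have HG: "?H \<subseteq> carrier G" using H subgroup.subset by blast
  have o: "ord a \<noteq> 0"
    using generate_pow_card[OF a(1)] a(2) subgroup.one_closed[OF A] by (metis card_0_eq empty_iff)
  show ?thesis unfolding mem_normalizer_finite_iff[OF HG fH b]
  proof
    assume "\<forall>h\<in>?H. inv b \<otimes> h \<otimes> b \<in> ?H"
    then show "inv b \<otimes> a [^] m \<otimes> b \<in> ?A" using m HA by blast
  next
    assume "inv b \<otimes> a [^] m \<otimes> b \<in> ?A"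
    then obtain r :: nat where r: "inv b \<otimes> a [^] m \<otimes> b = a [^] r"
      using generate_pow_nat[OF a(1) o] by auto
    have g: "ord (a [^] n) = ord a div gcd (ord a) n" for n
      using ord_pow_gen[OF a(1), of n] o by simp
    then have o': "ord (a [^] m) \<noteq> 0"
      using o by (simp add: dvd_div_eq_0_iff)
    define q where "q = ord a div gcd (ord a) m"
    \<comment> \<open>conjugates have equal order, and a cyclic group has one subgroup of each order\<close>
    have "ord a div gcd (ord a) r = q"
      using g ord_conj[OF b, of "a [^] m"] a r by (simp add: q_def)
    then have "gcd (ord a) r * q = ord a" by (metis dvd_mult_div_cancel gcd_dvd1)
    moreover have "gcd (ord a) m * q = ord a" by (simp add: q_def)
    ultimately have "gcd (ord a) r = gcd (ord a) m"
      using o by (metis mult_cancel2 mult_0_right)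
    then have "gcd (int m) (int (ord a)) dvd int r"
      unfolding gcd_int_int_eq of_nat_dvd_iff by (metis gcd.commute gcd_dvd2)
    \<comment> \<open>Bezout writes \<open>r\<close> as a multiple of \<open>m\<close> plus a
      multiple of \<open>ord a\<close>. The second part contributes the trivial power of
      \<open>a\<close>, so \<open>a [^] r\<close> is a power of \<open>a [^] m\<close>.\<close>
    then obtain p where "int r = p * gcd (int m) (int (ord a))" by (auto simp: dvd_def mult.commute)
    moreover obtain u v where "u * int m + v * int (ord a) = gcd (int m) (int (ord a))"
      using bezout_int by blast
    ultimately have "int r = int m * (p * u) + int (ord a) * (p * v)"
      by (simp add: algebra_simps flip: distrib_left)
    then have "a [^] int r = a [^] (int m * (p * u)) \<otimes> a [^] (int (ord a) * (p * v))"
      using a by (simp add: int_pow_mult)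
    also have "\<dots> = (a [^] m) [^] (p * u) \<otimes> (a [^] ord a) [^] (p * v)"
      using a by (simp add: int_pow_pow flip: int_pow_int)
    finally have "a [^] r = (a [^] m) [^] (p * u)" using a by (simp add: int_pow_int)
    then have "a [^] r \<in> ?H" using subgroup_int_pow_closed[OF H m] by simp
    show "\<forall>h\<in>?H. inv b \<otimes> h \<otimes> b \<in> ?H"
    proof
      fix h assume "h \<in> ?H"
      then obtain i :: nat where "h = (a [^] m) [^] i"
        using generate_pow_nat[of "a [^] m"] a o' by auto
      then have "inv b \<otimes> h \<otimes> b = (a [^] r) [^] i" using a b r by (simp add: conj_nat_pow)
      then show "inv b \<otimes> h \<otimes> b \<in> ?H"
        using subgroup_int_pow_closed[OF H \<open>a [^] r \<in> ?H\<close>, of "int i"] by (simp add: int_pow_int)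
    qed
  qed
qed

lemma (in group) subgroup_conj_vimage:
  assumes "subgroup H G" "b \<in> carrier G"
  shows "subgroup {x \<in> carrier G. inv b \<otimes> x \<otimes> b \<in> H} G"
proof (rule subgroupI)
  show "{x \<in> carrier G. inv b \<otimes> x \<otimes> b \<in> H} \<noteq> {}"
    using assms subgroup.one_closed[OF assms(1)] by (auto intro!: exI[of _ \<one>])
qed (use assms subgroup.m_closed[OF assms(1)] subgroup.m_inv_closed[OF assms(1)]
  in \<open>auto simp: conj_mult simp flip: conj_inv\<close>)

text \<open>The exponents \<open>i\<close> for which the conjugate of \<open>a [^] i\<close> stays
  in the subgroup generated by \<open>a\<close> form a subgroup of the integers, and such a subgroup
  consists of the multiples of its least positive element. That element is \<open>M\<close>.\<close>

lemma (in group) conj_int_pow_mem_generate_iff: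
  assumes a: "a \<in> carrier G" "finite (generate G {a})"
    and b: "b \<in> carrier G" "b \<notin> normalizer G (generate G {a})"
  defines "M \<equiv> LEAST m. 2 \<le> m \<and> m \<le> ord a \<and> b \<in> normalizer G (generate G {a [^] m})"
  shows "2 \<le> M" "inv b \<otimes> a [^] (i::int) \<otimes> b \<in> generate G {a} \<longleftrightarrow> int M dvd i"
proof -
  let ?A = "generate G {a}"
  let ?S = "{x \<in> carrier G. inv b \<otimes> x \<otimes> b \<in> ?A}"
  have A: "subgroup ?A G" using a by (auto intro: generate_is_subgroup)
  have S: "subgroup ?S G" by (rule subgroup_conj_vimage[OF A b(1)])
  have N: "b \<in> normalizer G (generate G {a [^] m}) \<longleftrightarrow> a [^] m \<in> ?S" for m :: nat
    using mem_normalizer_generate_pow_iff[OF a b(1)] a by simp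
  have o: "ord a \<noteq> 0"
    using generate_pow_card[OF a(1)] a(2) subgroup.one_closed[OF A] by (metis card_0_eq empty_iff)
  \<comment> \<open>The exponent 1 is excluded because \<open>b\<close> does not normalize the
    subgroup generated by \<open>a\<close>; hence starting the search for \<open>M\<close> at 2
    skips no admissible positive exponent.\<close>
  have S1: "a \<notin> ?S" using N[of 1] a b by simp
  have So: "a [^] ord a \<in> ?S" using a subgroup.one_closed[OF S] by simp
  \<comment> \<open>The witness that the \<open>LEAST\<close> is attained is \<open>ord a\<close>,
    which must therefore be at least 2.\<close>
  have "ord a \<noteq> 1"
  proof
    assume "ord a = 1"
    then have "a = \<one>" using pow_ord_eq_1[OF a(1)] a(1) by simp
    then show False using S1 subgroup.one_closed[OF S] by blast
  qed
  with o So have M: "2 \<le> M \<and> M \<le> ord a \<and> b \<in> normalizer G (generate G {a [^] M})"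
    unfolding M_def by - (rule LeastI[of _ "ord a"], use N in simp)
  then show "2 \<le> M" by simp
  have SM: "a [^] M \<in> ?S" using M N by simp
  have less: "a [^] m \<notin> ?S" if "2 \<le> m" "m < M" for m
    using that M N[of m] not_less_Least[of m] unfolding M_def by force
  have mult: "a [^] (int M * q) \<in> ?S" for q
    using subgroup_int_pow_closed[OF S SM] a by (simp add: int_pow_int flip: int_pow_pow)
  have "a [^] i \<in> ?S \<longleftrightarrow> int M dvd i"
  proof
    \<comment> \<open>Division with remainder: subtracting a multiple of \<open>M\<close> leaves an
      admissible exponent below \<open>M\<close>, which minimality and \<open>S1\<close> force to be
      0.\<close>
    assume "a [^] i \<in> ?S"
    then have "a [^] i \<otimes> inv (a [^] (int M * (i div int M))) \<in> ?S"
      using subgroup.m_closed[OF S] subgroup.m_inv_closed[OF S mult] by blast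
    also have "a [^] i \<otimes> inv (a [^] (int M * (i div int M))) = a [^] (i mod int M)"
      using int_pow_diff[OF a(1), of i "int M * (i div int M)"] by (simp add: minus_mult_div_eq_mod)
    also have "\<dots> = a [^] nat (i mod int M)"
      using int_pow_int[of G a "nat (i mod int M)"] M by simp
    finally have *: "a [^] nat (i mod int M) \<in> ?S" .
    have "nat (i mod int M) < M" using M by (simp add: nat_less_iff)
    then have "nat (i mod int M) < 2" using less[of "nat (i mod int M)"] * by (meson leI)
    moreover have "nat (i mod int M) \<noteq> 1" using * S1 a by fastforce
    ultimately have "nat (i mod int M) = 0" by linarith
    then show "int M dvd i" using M by (intro mod_0_imp_dvd) (simp add: order_antisym)
  qed (use mult in auto)
  then show "inv b \<otimes> a [^] i \<otimes> b \<in> ?A \<longleftrightarrow> int M dvd i" using a by simp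
qed

text \<open>This will cancel the two counts in the coefficients of a power of the unit. Since
  \<open>L dvd m\<close>, the range of indices consists of whole periods and can be rotated
  cyclically.\<close>

lemma card_shift_mod_eq:
  fixes P :: "int \<Rightarrow> bool" and k L m :: nat
  assumes P: "\<And>s t. int L dvd s - t \<Longrightarrow> P s = P t"
    and "coprime k L" "L dvd m"
  shows "card {j\<in>{..<m}. P (int (k * j) + 1)} = card {j\<in>{..<m}. P (int (k * j))}"
proof (cases "m = 0")
  case False
  \<comment> \<open>with \<open>s\<close> inverse to \<open>k\<close> modulo \<open>L\<close>, the shift \<open>j \<mapsto> j + s\<close> turns \<open>k j\<close> into \<open>k j + 1\<close>\<close>
  obtain u v where uv: "u * int k + v * int L = 1"
    using bezout_int[of "int k" "int L"] \<open>coprime k L\<close> by (auto simp: coprime_iff_gcd_eq_1)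
  \<comment> \<open>The Bezout coefficient \<open>u\<close> may be negative. Reducing it modulo
    \<open>m\<close> gives a natural number, which is still inverse to \<open>k\<close> modulo
    \<open>L\<close> because \<open>L dvd m\<close>.\<close>
  define s where "s = nat (u mod int m)"
  have "int s + int m * (u div int m) = u" using False by (simp add: s_def)
  then have "(int s + int m * (u div int m)) * int k + v * int L = 1" using uv by (simp only:)
  then have "int k * int s - 1 = - (int m * (u div int m) * int k) - v * int L"
    by (simp only: algebra_simps)
  then have s: "int L dvd int k * int s - 1"
    using \<open>L dvd m\<close> by (simp add: dvd_mult2)
  have inj: "inj_on (\<lambda>j. (j + s) mod m) {..<m}"
  proof (rule inj_onI)
    fix x y assume xy: "x \<in> {..<m}" "y \<in> {..<m}" "(x + s) mod m = (y + s) mod m"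
    then have "int ((x + s) mod m) = int ((y + s) mod m)" by simp
    then have "int m dvd (int x + int s) - (int y + int s)"
      by (simp only: of_nat_add of_nat_mod mod_eq_dvd_iff)
    then have "int x mod int m = int y mod int m" by (simp add: mod_eq_dvd_iff)
    then have "x mod m = y mod m" by (simp only: flip: of_nat_mod of_nat_eq_iff)
    then show "x = y" using xy by simp
  qed
  have surj: "(\<lambda>j. (j + s) mod m) ` {..<m} = {..<m}"
    by (rule endo_inj_surj[OF _ _ inj]) (use False in auto)
  \<comment> \<open>Reducing \<open>j + s\<close> modulo \<open>m\<close> changes the argument of
    \<open>P\<close> by a multiple of \<open>m\<close>, hence of \<open>L\<close>, which
    \<open>P\<close> does not see.\<close>
  have P': "P (int (k * ((j + s) mod m))) = P (int (k * j) + 1)" for j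
  proof (rule P)
    define p r where "p = (j + s) div m" and "r = (j + s) mod m"
    have "j + s = m * p + r" by (simp add: p_def r_def)
    then have "int k * (int j + int s) = int k * (int m * int p + int r)"
      by (metis of_nat_add of_nat_mult)
    then have "int (k * ((j + s) mod m)) - (int (k * j) + 1) =
        int k * int s - 1 - int m * (int k * int p)"
      by (simp add: algebra_simps flip: r_def)
    moreover have "int L dvd int k * int s - 1 - int m * (int k * int p)"
      by (rule dvd_diff[OF s]) (use \<open>L dvd m\<close> in \<open>simp add: dvd_mult2\<close>)
    ultimately show "int L dvd int (k * ((j + s) mod m)) - (int (k * j) + 1)"
      by (simp only: of_nat_mult)
  qed
  have "{j\<in>{..<m}. P (int (k * j))} = (\<lambda>j. (j + s) mod m) ` {j\<in>{..<m}. P (int (k * j) + 1)}"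
    (is "?R = ?f ` ?L")
  proof
    show "?R \<subseteq> ?f ` ?L"
    proof
      fix x assume x: "x \<in> ?R"
      then obtain j where "j < m" "x = (j + s) mod m" using surj by blast
      then show "x \<in> ?f ` ?L" using x P'[of j] by blast
    qed
    show "?f ` ?L \<subseteq> ?R" using P' False by auto
  qed
  moreover have "inj_on ?f ?L" by (rule inj_on_subset[OF inj]) blast
  ultimately show ?thesis by (simp only: card_image)
qed simp

section \<open>Coefficients in the group ring\<close>

text \<open>Right multiplication by \<open>c \<oplus> x\<close> fixes every
  \<open>c [^] i \<otimes> x\<close>, because \<open>x\<close> absorbs \<open>c\<close> and kills
  \<open>x\<close>. Each further factor therefore only adds the new term
  \<open>c [^] m \<otimes> x\<close>.\<close>

lemma (in ring) pow_add_square_zero: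
  assumes [simp]: "c \<in> carrier R" "x \<in> carrier R" and xc: "x \<otimes> c = x" and xx: "x \<otimes> x = \<zero>"
  shows "(c \<oplus> x) [^] (m::nat) = c [^] m \<oplus> (\<Oplus>i\<in>{..<m}. c [^] i \<otimes> x)"
proof (induction m)
  case (Suc m)
  define y where "y = (\<Oplus>i\<in>{..<m}. c [^] i \<otimes> x)"
  have y[simp]: "y \<in> carrier R" by (auto simp: y_def)
  have 1: "c [^] i \<otimes> x \<otimes> c = c [^] i \<otimes> x" "c [^] i \<otimes> x \<otimes> x = \<zero>" for i :: nat
    using xc xx by (simp_all add: m_assoc)
  have "y \<otimes> c = y" unfolding y_def by (subst finsum_ldistr) (auto simp: 1)
  moreover have "y \<otimes> x = \<zero>" unfolding y_def by (subst finsum_ldistr) (auto simp: 1)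
  ultimately have "(c [^] m \<oplus> y) \<otimes> (c \<oplus> x) = c [^] Suc m \<oplus> (c [^] m \<otimes> x \<oplus> y)"
    by (simp add: l_distr r_distr a_assoc a_comm[of y])
  also have "c [^] m \<otimes> x \<oplus> y = (\<Oplus>i\<in>{..<Suc m}. c [^] i \<otimes> x)"
    unfolding lessThan_Suc y_def by (subst finsum_insert) auto
  finally show ?case using Suc by (simp add: y_def)
qed simp

text \<open>By \<open>x \<otimes> c = x\<close> the element factors as (1 + x) c, and 1 + x has the
  inverse 1 - x. This explains the explicit inverse \<open>?d\<close>.\<close>

lemma (in ring) add_square_zero_Units:
  assumes c: "c \<in> Units R" and [simp]: "x \<in> carrier R" and xc: "x \<otimes> c = x" and xx: "x \<otimes> x = \<zero>"
  shows "c \<oplus> x \<in> Units R"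
proof -
  have [simp]: "c \<in> carrier R" "inv c \<in> carrier R" using c by auto
  have xi: "x \<otimes> inv c = x"
    using arg_cong[OF xc, of "\<lambda>y. y \<otimes> inv c"] c by (simp add: m_assoc)
  let ?d = "inv c \<ominus> inv c \<otimes> x"
  have "(c \<oplus> x) \<otimes> ?d = (c \<oplus> x) \<otimes> inv c \<ominus> (c \<oplus> x) \<otimes> inv c \<otimes> x"
    by (simp add: minus_eq r_distr r_minus m_assoc)
  also have "(c \<oplus> x) \<otimes> inv c = \<one> \<oplus> x" using c xi by (simp add: l_distr)
  also have "(\<one> \<oplus> x) \<otimes> x = x" using xx by (simp add: l_distr)
  also have "\<one> \<oplus> x \<ominus> x = \<one>" by (simp add: minus_eq a_assoc r_neg)
  finally have r: "(c \<oplus> x) \<otimes> ?d = \<one>" .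
  have "?d \<otimes> (c \<oplus> x) = inv c \<otimes> (c \<oplus> x) \<ominus> inv c \<otimes> (x \<otimes> (c \<oplus> x))"
    by (simp add: minus_eq l_distr l_minus m_assoc)
  also have "x \<otimes> (c \<oplus> x) = x" using xc xx by (simp add: r_distr)
  also have "inv c \<otimes> (c \<oplus> x) = \<one> \<oplus> inv c \<otimes> x" using c by (simp add: r_distr)
  also have "\<one> \<oplus> inv c \<otimes> x \<ominus> inv c \<otimes> x = \<one>" by (simp add: minus_eq a_assoc r_neg)
  finally show ?thesis using r unfolding Units_def by (auto intro!: bexI[of _ ?d])
qed

lemma (in ring) finsum_indicator:
  assumes "finite S"
  shows "(\<Oplus>i\<in>S. if P i then \<one> else \<zero>) = [card {i \<in> S. P i}] \<cdot> \<one>"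
proof -
  have "(\<Oplus>i\<in>S. if P i then \<one> else \<zero>) = (\<Oplus>i\<in>{i \<in> S. P i}. \<one>)"
    by (rule add.finprod_mono_neutral_cong_right) (use assms in auto)
  then show ?thesis using add.finprod_const[of \<one> "{i \<in> S. P i}"] by simp
qed

section \<open>Values of group ring elements, and the element \<open>gr_hat K G a\<close>\<close>

locale group_ring_setting = K: cring K + G: group G
  for K :: "('k, 'm) ring_scheme" (structure) and G :: "('g, 'n) monoid_scheme"
begin

abbreviation "KG \<equiv> group_ring K G"

sublocale KG: ring KG
  by (rule group_ring_ring[OF K.is_cring G.is_group])

lemma zero_apply: "\<zero>\<^bsub>KG\<^esub> x = \<zero>"
  by (simp add: group_ring_def)

lemma add_apply: "(f \<oplus>\<^bsub>KG\<^esub> g) x = f x \<oplus> g x"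
  by (simp add: group_ring_def)

lemmas
  apply_closed [simp] = group_ring_carrierD(1)[OF K.is_cring G.is_group] and
  apply_outside = group_ring_carrierD(4)[OF K.is_cring G.is_group] and
  mult_outside = group_ring_mult_outside[OF K.is_cring G.is_group] and
  gr_of_in_carrier [simp] = gr_of_closed[OF K.is_cring G.is_group] and
  gr_of_mult_apply = gr_of_mult_left[OF K.is_cring G.is_group] and
  mult_gr_of_apply = gr_of_mult_right[OF K.is_cring G.is_group] and
  one_eq_gr_of = group_ring_one[OF K.is_cring G.is_group]

text \<open>The additive inverse in a ring is given by a definite description, so its values are not
  read off the record; they are found by adding \<open>g\<close> back and cancelling.\<close>

lemma minus_apply:
  assumes [simp]: "f \<in> carrier KG" "g \<in> carrier KG"
  shows "(f \<ominus>\<^bsub>KG\<^esub> g) x = f x \<ominus> g x"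
proof -
  have "f \<ominus>\<^bsub>KG\<^esub> g \<oplus>\<^bsub>KG\<^esub> g = f" by (simp add: KG.minus_eq KG.a_assoc KG.l_neg)
  then have "(f \<ominus>\<^bsub>KG\<^esub> g) x \<oplus> g x = f x" by (simp only: flip: add_apply)
  then have "f x \<ominus> g x = (f \<ominus>\<^bsub>KG\<^esub> g) x \<oplus> g x \<ominus> g x" by simp
  also have "\<dots> = (f \<ominus>\<^bsub>KG\<^esub> g) x" by (simp add: K.minus_eq K.a_assoc K.r_neg)
  finally show ?thesis by simp
qed

lemma finsum_apply:
  assumes "finite S" "\<And>i. i \<in> S \<Longrightarrow> f i \<in> carrier KG"
  shows "(\<Oplus>\<^bsub>KG\<^esub>i\<in>S. f i) x = (\<Oplus>i\<in>S. f i x)"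
  using assms
proof (induction S rule: finite_induct)
  case (insert i S)
  then have "(\<Oplus>\<^bsub>KG\<^esub>i\<in>insert i S. f i) x = f i x \<oplus> (\<Oplus>i\<in>S. f i x)"
    by (subst KG.finsum_insert) (auto simp: add_apply)
  also have "\<dots> = (\<Oplus>i\<in>insert i S. f i x)"
    using insert by (subst K.finsum_insert) auto
  finally show ?case .
qed (simp add: zero_apply)

lemma gr_of_mult_gr_of:
  assumes "g \<in> carrier G" "h \<in> carrier G"
  shows "gr_of K g \<otimes>\<^bsub>KG\<^esub> gr_of K h = gr_of K (g \<otimes>\<^bsub>G\<^esub> h)"
proof
  fix x
  have "inv\<^bsub>G\<^esub> g \<otimes>\<^bsub>G\<^esub> x = h \<longleftrightarrow> x = g \<otimes>\<^bsub>G\<^esub> h" if "x \<in> carrier G"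
    using assms(2,1) that by (rule G.inv_solve_left')
  then show "(gr_of K g \<otimes>\<^bsub>KG\<^esub> gr_of K h) x = gr_of K (g \<otimes>\<^bsub>G\<^esub> h) x"
    using assms by (cases "x \<in> carrier G")
      (simp_all add: gr_of_mult_apply mult_outside apply_outside[OF gr_of_in_carrier], simp_all add: gr_of_def)
qed

lemma gr_of_pow:
  assumes "g \<in> carrier G"
  shows "gr_of K g [^]\<^bsub>KG\<^esub> (n::nat) = gr_of K (g [^]\<^bsub>G\<^esub> n)"
proof (induction n)
  case (Suc n)
  then show ?case using assms by (simp add: gr_of_mult_gr_of)
qed (simp add: one_eq_gr_of)

lemma gr_of_Units:
  assumes "g \<in> carrier G"
  shows "gr_of K g \<in> Units KG"
proof -
  have "gr_of K g \<otimes>\<^bsub>KG\<^esub> gr_of K (inv\<^bsub>G\<^esub> g) = \<one>\<^bsub>KG\<^esub>" "gr_of K (inv\<^bsub>G\<^esub> g) \<otimes>\<^bsub>KG\<^esub> gr_of K g = \<one>\<^bsub>KG\<^esub>"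
    using assms by (simp_all add: gr_of_mult_gr_of one_eq_gr_of)
  then show ?thesis using assms unfolding Units_def by (auto simp del: apply_closed intro!: bexI[of _ "gr_of K (inv\<^bsub>G\<^esub> g)"])
qed

lemma gr_hat_closed: "a \<in> carrier G \<Longrightarrow> gr_hat K G a \<in> carrier KG"
  unfolding gr_hat_def by (auto intro!: KG.finsum_closed)

text \<open>Every element of the finite cyclic subgroup is \<open>a [^] i\<close> for exactly one
  \<open>i\<close> from 1 to the order, so the sum of these powers is the indicator function of the
  subgroup.\<close>

lemma gr_hat_apply:
  assumes a: "a \<in> carrier G" "G.ord a \<noteq> 0"
  shows "gr_hat K G a x = (if x \<in> generate G {a} then \<one> else \<zero>)"
proof -
  let ?S = "{i \<in> {1..G.ord a}. x = a [^]\<^bsub>G\<^esub> i}"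
  have inj: "i = j" if "i \<in> ?S" "j \<in> ?S" for i j
    using that inj_onD[OF G.ord_inj'[OF a(1)]] by auto
  have "gr_hat K G a x = (\<Oplus>i\<in>{1..G.ord a}. if x = a [^]\<^bsub>G\<^esub> i then \<one> else \<zero>)"
    unfolding gr_hat_def using a by (subst finsum_apply) (simp_all, simp add: gr_of_def)
  also have "\<dots> = [card ?S] \<cdot> \<one>" by (rule K.finsum_indicator) simp
  also have "card ?S = (if x \<in> generate G {a} then 1 else 0)"
  proof (cases "x \<in> generate G {a}")
    case True
    then obtain n :: nat where n: "x = a [^]\<^bsub>G\<^esub> n" using G.generate_pow_nat[OF a] by auto
    have "\<exists>i. i \<in> ?S"
    \<comment> \<open>The index range starts at 1, so the identity is represented by the exponent
      \<open>G.ord a\<close> and not by the remainder 0.\<close>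
    proof (cases "G.ord a dvd n")
      case True
      then show ?thesis using a n G.pow_eq_id[OF a(1)] by (auto intro!: exI[of _ "G.ord a"])
    next
      case False
      have "a [^]\<^bsub>G\<^esub> (G.ord a * (n div G.ord a)) = \<one>\<^bsub>G\<^esub>"
        using a(1) by (simp add: G.pow_eq_id)
      then have "a [^]\<^bsub>G\<^esub> n = a [^]\<^bsub>G\<^esub> (n mod G.ord a)"
        using a(1) G.nat_pow_mult[of a "G.ord a * (n div G.ord a)" "n mod G.ord a"] by simp
      moreover have "n mod G.ord a \<in> {1..G.ord a}"
        using False a(2) mod_less_divisor[of "G.ord a" n] by (auto simp: mod_greater_zero_iff_not_dvd Suc_le_eq intro: less_imp_le)
      ultimately show ?thesis using n by blast
    qed
    then obtain i where "i \<in> ?S" by blast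
    then have "?S = {i}" using inj by blast
    then show ?thesis using True by simp
  next
    case False
    then have "?S = {}" using G.generate_pow_nat[OF a] by blast
    then show ?thesis using False by simp
  qed
  finally show ?thesis by simp
qed

lemma gr_hat_mult_gr_of:
  assumes a: "a \<in> carrier G" "G.ord a \<noteq> 0" and h: "h \<in> generate G {a}"
  shows "gr_hat K G a \<otimes>\<^bsub>KG\<^esub> gr_of K h = gr_hat K G a"
proof
  fix x
  have A: "subgroup (generate G {a}) G" by (rule G.generate_is_subgroup) (use a in simp)
  then have hG: "h \<in> carrier G" using h by (rule subgroup.mem_carrier)
  show "(gr_hat K G a \<otimes>\<^bsub>KG\<^esub> gr_of K h) x = gr_hat K G a x"
  proof (cases "x \<in> carrier G")
    case True
    have "x \<otimes>\<^bsub>G\<^esub> inv\<^bsub>G\<^esub> h \<in> generate G {a} \<longleftrightarrow> x \<in> generate G {a}"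
    proof
      assume "x \<otimes>\<^bsub>G\<^esub> inv\<^bsub>G\<^esub> h \<in> generate G {a}"
      then have "x \<otimes>\<^bsub>G\<^esub> inv\<^bsub>G\<^esub> h \<otimes>\<^bsub>G\<^esub> h \<in> generate G {a}" using h by (rule subgroup.m_closed[OF A])
      then show "x \<in> generate G {a}" using True hG by (simp add: G.m_assoc)
    next
      assume "x \<in> generate G {a}"
      then show "x \<otimes>\<^bsub>G\<^esub> inv\<^bsub>G\<^esub> h \<in> generate G {a}"
        using subgroup.m_inv_closed[OF A h] by (rule subgroup.m_closed[OF A])
    qed
    then show ?thesis
      by (simp only: mult_gr_of_apply[OF hG gr_hat_closed[OF a(1)] True] gr_hat_apply[OF a])
  next
    case False
    then show ?thesis by (simp only: apply_outside[OF gr_hat_closed[OF a(1)] False] mult_outside[OF False])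
  qed
qed

end

section \<open>Powers of the units\<close>

lemma (in abelian_group) finsum_diff:
  assumes "f \<in> S \<rightarrow> carrier G" "g \<in> S \<rightarrow> carrier G"
  shows "(\<Oplus>i\<in>S. f i \<ominus> g i) = (\<Oplus>i\<in>S. f i) \<ominus> (\<Oplus>i\<in>S. g i)"
proof -
  have [simp]: "f i \<in> carrier G" "g i \<in> carrier G" if "i \<in> S" for i using assms that by auto
  have "(\<Oplus>i\<in>S. f i) = (\<Oplus>i\<in>S. (f i \<ominus> g i) \<oplus> g i)"
    by (rule finsum_cong') (use assms in \<open>auto simp: minus_eq a_assoc l_neg\<close>)
  also have "\<dots> = (\<Oplus>i\<in>S. f i \<ominus> g i) \<oplus> (\<Oplus>i\<in>S. g i)"
    by (rule finsum_addf) (use assms in auto)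
  finally have e: "(\<Oplus>i\<in>S. f i) = (\<Oplus>i\<in>S. f i \<ominus> g i) \<oplus> (\<Oplus>i\<in>S. g i)" .
  have [simp]: "(\<Oplus>i\<in>S. f i \<ominus> g i) \<in> carrier G" "(\<Oplus>i\<in>S. g i) \<in> carrier G"
    using assms by (auto intro: finsum_closed)
  show ?thesis unfolding e by (simp only: minus_eq a_assoc r_neg r_zero a_inv_closed
      \<open>(\<Oplus>i\<in>S. f i \<ominus> g i) \<in> carrier G\<close>[unfolded minus_eq] \<open>(\<Oplus>i\<in>S. g i) \<in> carrier G\<close>)
qed

section \<open>The square-zero element \<open>w\<close> and the coefficients of powers of the
  unit\<close>

locale bicyclic_setting = group_ring_setting K G
  for K :: "('k, 'm) ring_scheme" (structure) and G :: "('g, 'n) monoid_scheme" +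
  fixes a b :: 'g
  assumes a [simp]: "a \<in> carrier G" and b [simp]: "b \<in> carrier G" and ord_a: "G.ord a \<noteq> 0"
begin

abbreviation "A \<equiv> generate G {a}"

lemma subgroup_A: "subgroup A G"
  by (rule G.generate_is_subgroup) simp

lemma int_pow_in_A: "a [^]\<^bsub>G\<^esub> (i::int) \<in> A"
  using G.generate_pow[OF a] by auto

definition w where "w = (gr_of K a \<ominus>\<^bsub>KG\<^esub> \<one>\<^bsub>KG\<^esub>) \<otimes>\<^bsub>KG\<^esub> gr_of K b \<otimes>\<^bsub>KG\<^esub> gr_hat K G a"

lemma hat_closed [simp]: "gr_hat K G a \<in> carrier KG"
  by (rule gr_hat_closed) simp

lemma w_closed [simp]: "w \<in> carrier KG"
  by (simp add: w_def)

lemma w_mult_gr_of: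
  assumes "h \<in> A"
  shows "w \<otimes>\<^bsub>KG\<^esub> gr_of K h = w"
proof -
  have [simp]: "h \<in> carrier G" using subgroup.mem_carrier[OF subgroup_A assms] .
  show ?thesis by (simp add: w_def KG.m_assoc gr_hat_mult_gr_of[OF a ord_a assms])
qed

text \<open>The right end of \<open>w\<close> absorbs \<open>a\<close>, so \<open>w\<close>
  annihilates a - 1, which is the left factor of \<open>w\<close>.\<close>

lemma w_square: "w \<otimes>\<^bsub>KG\<^esub> w = \<zero>\<^bsub>KG\<^esub>"
proof -
  have "a \<in> A" by (simp add: generate.incl)
  then have "w \<otimes>\<^bsub>KG\<^esub> (gr_of K a \<ominus>\<^bsub>KG\<^esub> \<one>\<^bsub>KG\<^esub>) = \<zero>\<^bsub>KG\<^esub>"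
    by (simp add: KG.minus_eq KG.r_distr KG.r_minus w_mult_gr_of KG.r_neg)
  then have "w \<otimes>\<^bsub>KG\<^esub> (gr_of K a \<ominus>\<^bsub>KG\<^esub> \<one>\<^bsub>KG\<^esub>) \<otimes>\<^bsub>KG\<^esub> gr_of K b \<otimes>\<^bsub>KG\<^esub> gr_hat K G a = \<zero>\<^bsub>KG\<^esub>"
    by simp
  moreover have "w \<otimes>\<^bsub>KG\<^esub> (gr_of K a \<ominus>\<^bsub>KG\<^esub> \<one>\<^bsub>KG\<^esub>) \<otimes>\<^bsub>KG\<^esub> gr_of K b \<otimes>\<^bsub>KG\<^esub> gr_hat K G a =
      w \<otimes>\<^bsub>KG\<^esub> ((gr_of K a \<ominus>\<^bsub>KG\<^esub> \<one>\<^bsub>KG\<^esub>) \<otimes>\<^bsub>KG\<^esub> gr_of K b \<otimes>\<^bsub>KG\<^esub> gr_hat K G a)"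
    by (simp only: KG.m_assoc w_closed gr_of_in_carrier a b hat_closed KG.minus_closed KG.one_closed KG.m_closed)
  ultimately show ?thesis by (simp only: w_def)
qed

text \<open>Expanding the factor a - 1 shows \<open>w\<close> as the indicator function of the coset
  \<open>a b A\<close> minus that of \<open>b A\<close>.\<close>

lemma w_apply:
  assumes g: "g \<in> carrier G"
  shows "w g = (if inv\<^bsub>G\<^esub> b \<otimes>\<^bsub>G\<^esub> (inv\<^bsub>G\<^esub> a \<otimes>\<^bsub>G\<^esub> g) \<in> A then \<one> else \<zero>) \<ominus>
    (if inv\<^bsub>G\<^esub> b \<otimes>\<^bsub>G\<^esub> g \<in> A then \<one> else \<zero>)"
proof -
  let ?h = "gr_of K b \<otimes>\<^bsub>KG\<^esub> gr_hat K G a"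
  have h: "?h x = (if inv\<^bsub>G\<^esub> b \<otimes>\<^bsub>G\<^esub> x \<in> A then \<one> else \<zero>)" if "x \<in> carrier G" for x
    using that by (simp only: gr_of_mult_apply[OF b hat_closed that] gr_hat_apply[OF a ord_a])
  have hc: "?h \<in> carrier KG" by simp
  have "w = gr_of K a \<otimes>\<^bsub>KG\<^esub> ?h \<ominus>\<^bsub>KG\<^esub> ?h"
    by (simp add: w_def KG.minus_eq KG.l_distr KG.l_minus KG.m_assoc)
  then have "w g = (gr_of K a \<otimes>\<^bsub>KG\<^esub> ?h) g \<ominus> ?h g"
    by (simp only: minus_apply KG.m_closed hc gr_of_in_carrier a)
  then show ?thesis
    using g by (simp only: gr_of_mult_apply[OF a hc g] h G.m_closed G.inv_closed a)
qed

lemma gr_u_eq: "gr_u K G a b k = gr_of K (a [^]\<^bsub>G\<^esub> k) \<oplus>\<^bsub>KG\<^esub> w"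
  by (simp add: gr_u_def w_def)

lemma gr_u_Units: "gr_u K G a b k \<in> Units KG"
  unfolding gr_u_eq
  by (rule KG.add_square_zero_Units)
    (use int_pow_in_A[of "int k"] in \<open>simp_all add: gr_of_Units w_mult_gr_of w_square int_pow_int\<close>)

text \<open>The translate of \<open>g\<close> by \<open>a\<^sup>-\<^sup>t\<close> lies in the coset \<open>b A\<close>.\<close>
abbreviation "P g t \<equiv> inv\<^bsub>G\<^esub> b \<otimes>\<^bsub>G\<^esub> (a [^]\<^bsub>G\<^esub> (- t :: int) \<otimes>\<^bsub>G\<^esub> g) \<in> A"

lemma gr_u_pow_apply:
  assumes g: "g \<in> carrier G"
  shows "(gr_u K G a b k [^]\<^bsub>KG\<^esub> m) g = gr_of K (a [^]\<^bsub>G\<^esub> (k * m)) g \<oplus>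
    ([card {i\<in>{..<m}. P g (int (k * i) + 1)}] \<cdot> \<one> \<ominus> [card {i\<in>{..<m}. P g (int (k * i))}] \<cdot> \<one>)"
proof -
  let ?c = "gr_of K (a [^]\<^bsub>G\<^esub> k)"
  have cc: "?c [^]\<^bsub>KG\<^esub> i = gr_of K (a [^]\<^bsub>G\<^esub> (k * i))" for i :: nat
    by (simp add: gr_of_pow G.nat_pow_pow)
  have *: "(gr_of K (a [^]\<^bsub>G\<^esub> (k * i)) \<otimes>\<^bsub>KG\<^esub> w) g =
    (if P g (int (k * i) + 1) then \<one> else \<zero>) \<ominus> (if P g (int (k * i)) then \<one> else \<zero>)" for i
  proof -
    have e: "inv\<^bsub>G\<^esub> (a [^]\<^bsub>G\<^esub> (k * i)) = a [^]\<^bsub>G\<^esub> (- int (k * i))"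
      using G.int_pow_neg[OF a, of "int (k * i)"] by (simp only: int_pow_int)
    \<comment> \<open>The extra \<open>a\<close> from the factor a - 1 moves the exponent from k i
      to k i + 1; this is the origin of the two different counts.\<close>
    have "inv\<^bsub>G\<^esub> a \<otimes>\<^bsub>G\<^esub> (a [^]\<^bsub>G\<^esub> (- int (k * i)) \<otimes>\<^bsub>G\<^esub> g) = a [^]\<^bsub>G\<^esub> (-1 + - int (k * i)) \<otimes>\<^bsub>G\<^esub> g"
      unfolding G.int_pow_mult[OF a] using g G.int_pow_neg[OF a, of 1]
      by (simp add: G.m_assoc)
    moreover have "-1 + - int (k * i) = - (int (k * i) + 1)" by simp
    ultimately have f: "inv\<^bsub>G\<^esub> a \<otimes>\<^bsub>G\<^esub> (a [^]\<^bsub>G\<^esub> (- int (k * i)) \<otimes>\<^bsub>G\<^esub> g) = a [^]\<^bsub>G\<^esub> (- (int (k * i) + 1)) \<otimes>\<^bsub>G\<^esub> g"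
      by (simp only:)
    have "(gr_of K (a [^]\<^bsub>G\<^esub> (k * i)) \<otimes>\<^bsub>KG\<^esub> w) g = w (a [^]\<^bsub>G\<^esub> (- int (k * i)) \<otimes>\<^bsub>G\<^esub> g)"
      unfolding e[symmetric] by (rule gr_of_mult_apply) (use g in simp_all)
    also have "\<dots> = (if P g (int (k * i) + 1) then \<one> else \<zero>) \<ominus> (if P g (int (k * i)) then \<one> else \<zero>)"
      by (subst w_apply) (use g in \<open>simp_all only: f G.m_closed G.int_pow_closed a\<close>)
    finally show ?thesis .
  qed
  have "gr_u K G a b k [^]\<^bsub>KG\<^esub> m =
      ?c [^]\<^bsub>KG\<^esub> m \<oplus>\<^bsub>KG\<^esub> (\<Oplus>\<^bsub>KG\<^esub>i\<in>{..<m}. ?c [^]\<^bsub>KG\<^esub> i \<otimes>\<^bsub>KG\<^esub> w)"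
    unfolding gr_u_eq using int_pow_in_A[of "int k"]
    by (intro KG.pow_add_square_zero) (simp_all add: w_mult_gr_of w_square int_pow_int)
  then have "(gr_u K G a b k [^]\<^bsub>KG\<^esub> m) g = gr_of K (a [^]\<^bsub>G\<^esub> (k * m)) g \<oplus>
      (\<Oplus>\<^bsub>KG\<^esub>i\<in>{..<m}. gr_of K (a [^]\<^bsub>G\<^esub> (k * i)) \<otimes>\<^bsub>KG\<^esub> w) g"
    by (simp only: add_apply cc)
  also have "(\<Oplus>\<^bsub>KG\<^esub>i\<in>{..<m}. gr_of K (a [^]\<^bsub>G\<^esub> (k * i)) \<otimes>\<^bsub>KG\<^esub> w) g =
      (\<Oplus>i\<in>{..<m}. (gr_of K (a [^]\<^bsub>G\<^esub> (k * i)) \<otimes>\<^bsub>KG\<^esub> w) g)"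
    by (rule finsum_apply) simp_all
  also have "\<dots> = (\<Oplus>i\<in>{..<m}. if P g (int (k * i) + 1) then \<one> else \<zero>) \<ominus>
      (\<Oplus>i\<in>{..<m}. if P g (int (k * i)) then \<one> else \<zero>)"
    unfolding * by (rule K.finsum_diff) auto
  also have "\<dots> = [card {i\<in>{..<m}. P g (int (k * i) + 1)}] \<cdot> \<one> \<ominus> [card {i\<in>{..<m}. P g (int (k * i))}] \<cdot> \<one>"
    by (simp only: K.finsum_indicator finite_lessThan)
  finally show ?thesis .
qed

end

section \<open>When a power of the unit is one, in terms of the period \<open>L\<close>\<close>

context bicyclic_setting begin

context
  fixes L :: nat
  assumes conj_in_A: "\<And>i::int. inv\<^bsub>G\<^esub> b \<otimes>\<^bsub>G\<^esub> a [^]\<^bsub>G\<^esub> i \<otimes>\<^bsub>G\<^esub> b \<in> A \<longleftrightarrow> int L dvd i"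
    and L: "2 \<le> L"
begin

lemma L_dvd_ord: "L dvd G.ord a"
proof -
  have "inv\<^bsub>G\<^esub> b \<otimes>\<^bsub>G\<^esub> a [^]\<^bsub>G\<^esub> int (G.ord a) \<otimes>\<^bsub>G\<^esub> b \<in> A"
    using subgroup.one_closed[OF subgroup_A] by (simp add: int_pow_int)
  then show ?thesis by (simp only: conj_in_A of_nat_dvd_iff)
qed

text \<open>If a translate of \<open>b A\<close> met \<open>A\<close>, then \<open>b\<close> would
  lie in \<open>A\<close> and conjugation by \<open>b\<close> would keep \<open>a\<close> in
  \<open>A\<close>, so \<open>L\<close> would divide 1. Hence the summand coming from
  \<open>w\<close> vanishes on \<open>A\<close>.\<close>

lemma not_P_int_pow: "\<not> P (a [^]\<^bsub>G\<^esub> (j::int)) t"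
proof
  assume "P (a [^]\<^bsub>G\<^esub> j) t"
  then have "inv\<^bsub>G\<^esub> b \<otimes>\<^bsub>G\<^esub> a [^]\<^bsub>G\<^esub> (- t + j) \<in> A" by (simp only: G.int_pow_mult a)
  then have "inv\<^bsub>G\<^esub> b \<otimes>\<^bsub>G\<^esub> a [^]\<^bsub>G\<^esub> (- t + j) \<otimes>\<^bsub>G\<^esub> inv\<^bsub>G\<^esub> (a [^]\<^bsub>G\<^esub> (- t + j)) \<in> A"
    by (rule subgroup.m_closed[OF subgroup_A _ subgroup.m_inv_closed[OF subgroup_A int_pow_in_A]])
  then have 1: "inv\<^bsub>G\<^esub> b \<in> A" by (simp add: G.m_assoc)
  then have 2: "b \<in> A" using subgroup.m_inv_closed[OF subgroup_A 1] by simp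
  have "inv\<^bsub>G\<^esub> b \<otimes>\<^bsub>G\<^esub> a [^]\<^bsub>G\<^esub> (1::int) \<otimes>\<^bsub>G\<^esub> b \<in> A"
    using subgroup.m_closed[OF subgroup_A subgroup.m_closed[OF subgroup_A 1 int_pow_in_A] 2] .
  then show False using L conj_in_A[of 1] by simp
qed

text \<open>Multiplying the element tested by \<open>P g t\<close> on the left by the conjugate of
  \<open>a\<close> to the power t - s, which lies in \<open>A\<close>, gives the element tested by
  \<open>P g s\<close>.\<close>

lemma P_periodic:
  assumes g: "g \<in> carrier G" and "int L dvd s - t" and "P g t"
  shows "P g s"
proof -
  have "inv\<^bsub>G\<^esub> b \<otimes>\<^bsub>G\<^esub> a [^]\<^bsub>G\<^esub> (t - s) \<otimes>\<^bsub>G\<^esub> b \<in> A"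
    using assms(2) by (simp only: conj_in_A dvd_diff_commute)
  then have "inv\<^bsub>G\<^esub> b \<otimes>\<^bsub>G\<^esub> a [^]\<^bsub>G\<^esub> (t - s) \<otimes>\<^bsub>G\<^esub> b \<otimes>\<^bsub>G\<^esub> (inv\<^bsub>G\<^esub> b \<otimes>\<^bsub>G\<^esub> (a [^]\<^bsub>G\<^esub> (- t) \<otimes>\<^bsub>G\<^esub> g)) \<in> A"
    using assms(3) by (rule subgroup.m_closed[OF subgroup_A])
  also have "inv\<^bsub>G\<^esub> b \<otimes>\<^bsub>G\<^esub> a [^]\<^bsub>G\<^esub> (t - s) \<otimes>\<^bsub>G\<^esub> b \<otimes>\<^bsub>G\<^esub> (inv\<^bsub>G\<^esub> b \<otimes>\<^bsub>G\<^esub> (a [^]\<^bsub>G\<^esub> (- t) \<otimes>\<^bsub>G\<^esub> g)) =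
      inv\<^bsub>G\<^esub> b \<otimes>\<^bsub>G\<^esub> (a [^]\<^bsub>G\<^esub> (t - s + - t) \<otimes>\<^bsub>G\<^esub> g)"
    unfolding G.int_pow_mult[OF a] using g by (simp add: G.m_assoc G.inv_mult_cancel_left)
  also have "t - s + - t = - s" by simp
  finally show ?thesis .
qed

text \<open>At the point \<open>a [^] (k * m)\<close> of \<open>A\<close> only the first summand
  contributes, with coefficient 1, whereas the identity is supported at the neutral element
  alone.\<close>

lemma pow_eq_one_if_gr_u_pow_eq_one:
  assumes "\<one> \<noteq> \<zero>" and "gr_u K G a b k [^]\<^bsub>KG\<^esub> m = \<one>\<^bsub>KG\<^esub>"
  shows "a [^]\<^bsub>G\<^esub> (k * m) = \<one>\<^bsub>G\<^esub>"
proof -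
  let ?g = "a [^]\<^bsub>G\<^esub> (k * m)"
  have n: "P ?g t = False" for t using not_P_int_pow[where j = "int (k * m)"] by (simp only: int_pow_int)
  have "gr_of K \<one>\<^bsub>G\<^esub> ?g = (gr_u K G a b k [^]\<^bsub>KG\<^esub> m) ?g" using assms(2) by (simp only: one_eq_gr_of)
  also have "\<dots> = gr_of K ?g ?g \<oplus> ([card {i\<in>{..<m}. P ?g (int (k * i) + 1)}] \<cdot> \<one> \<ominus> [card {i\<in>{..<m}. P ?g (int (k * i))}] \<cdot> \<one>)"
    by (rule gr_u_pow_apply) simp
  also have "\<dots> = \<one>" unfolding n by (simp add: gr_of_def K.minus_eq)
  finally show ?thesis using assms(1) by (simp add: gr_of_def split: if_splits)
qed

text \<open>Since \<open>L\<close> divides the order of \<open>a\<close>, it divides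
  \<open>k * m\<close>, hence \<open>m\<close> by coprimality. The two counts then agree at every
  \<open>g\<close>, whatever the characteristic.\<close>

lemma gr_u_pow_eq_one:
  assumes "coprime k L" and "a [^]\<^bsub>G\<^esub> (k * m) = \<one>\<^bsub>G\<^esub>"
  shows "gr_u K G a b k [^]\<^bsub>KG\<^esub> m = \<one>\<^bsub>KG\<^esub>"
proof
  fix g
  have "G.ord a dvd k * m" using assms(2) by (simp only: G.pow_eq_id a)
  then have "L dvd m"
    using L_dvd_ord assms(1) by (metis coprime_commute coprime_dvd_mult_right_iff dvd_trans)
  show "(gr_u K G a b k [^]\<^bsub>KG\<^esub> m) g = \<one>\<^bsub>KG\<^esub> g"
  proof (cases "g \<in> carrier G")
    case True
    have "card {j\<in>{..<m}. P g (int (k * j) + 1)} = card {j\<in>{..<m}. P g (int (k * j))}"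
    proof (rule card_shift_mod_eq[OF _ assms(1) \<open>L dvd m\<close>])
      fix s t assume st: "int L dvd s - t"
      then have "int L dvd t - s" by (simp only: dvd_diff_commute)
      with st show "P g s = P g t" using P_periodic[OF True] by blast
    qed
    then have "(gr_u K G a b k [^]\<^bsub>KG\<^esub> m) g = gr_of K \<one>\<^bsub>G\<^esub> g \<oplus>
        ([card {j\<in>{..<m}. P g (int (k * j))}] \<cdot> \<one> \<ominus> [card {j\<in>{..<m}. P g (int (k * j))}] \<cdot> \<one>)"
      by (simp only: gr_u_pow_apply[OF True] assms(2))
    then show ?thesis by (simp add: K.minus_eq K.r_neg one_eq_gr_of)
  next
    case False
    have u: "gr_u K G a b k \<in> carrier KG" using gr_u_Units by (rule KG.Units_closed)
    show ?thesis
      by (simp only: apply_outside[OF KG.nat_pow_closed[OF u] False] apply_outside[OF KG.one_closed False])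
  qed
qed

text \<open>The coefficient at \<open>b\<close>, a point outside \<open>A\<close>, decides. No
  \<open>k * i + 1\<close> is divisible by \<open>L\<close>, as a common divisor of \<open>k\<close>
  and \<open>L\<close> would divide 1, while the index 0 makes the other count \<open>N\<close>
  positive. What remains is minus \<open>N\<close> times one, nonzero in characteristic
  zero.\<close>

lemma gr_u_pow_neq_one:
  assumes "char_zero K" and "\<not> coprime k L" and "0 < (m::nat)"
  shows "gr_u K G a b k [^]\<^bsub>KG\<^esub> m \<noteq> \<one>\<^bsub>KG\<^esub>"
proof
  assume u: "gr_u K G a b k [^]\<^bsub>KG\<^esub> m = \<one>\<^bsub>KG\<^esub>"
  have bA: "b \<notin> A"
  proof
    assume "b \<in> A"
    then obtain j :: int where "b = a [^]\<^bsub>G\<^esub> j" using G.generate_pow[OF a] by auto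
    then have "P (a [^]\<^bsub>G\<^esub> j) 0" using subgroup.one_closed[OF subgroup_A] by simp
    then show False using not_P_int_pow by blast
  qed
  have P: "P b t \<longleftrightarrow> int L dvd t" for t
    using conj_in_A[of "- t"] by (simp add: G.m_assoc)
  define N where "N = card {i\<in>{..<m}. P b (int (k * i))}"
  have "0 \<in> {i\<in>{..<m}. P b (int (k * i))}" using assms(3) P[of 0] by simp
  then have N: "0 < N" unfolding N_def by (subst card_gt_0_iff) auto
  have no: "\<not> int L dvd int (k * i) + 1" for i :: nat
  proof
    assume "int L dvd int (k * i) + 1"
    then have "int L dvd int (k * i + 1)" by (simp only: of_nat_add of_nat_1)
    then have "L dvd k * i + 1" by (simp only: of_nat_dvd_iff)
    then have "gcd k L dvd k * i + 1" using dvd_trans gcd_dvd2 by blast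
    then have "gcd k L dvd 1" using dvd_add_right_iff[of "gcd k L" "k * i" 1] by simp
    then show False using assms(2) by (simp add: coprime_iff_gcd_eq_1)
  qed
  have "b \<noteq> \<one>\<^bsub>G\<^esub>" "b \<noteq> a [^]\<^bsub>G\<^esub> (k * m)"
    using bA subgroup.one_closed[OF subgroup_A] int_pow_in_A[of "int (k * m)"] by (auto simp only: int_pow_int)
  then have z: "gr_of K (a [^]\<^bsub>G\<^esub> (k * m)) b = \<zero>" and "\<zero> = gr_of K \<one>\<^bsub>G\<^esub> b"
    by (simp_all only: gr_of_def if_False)
  note this(2)
  also have "gr_of K \<one>\<^bsub>G\<^esub> b = (gr_u K G a b k [^]\<^bsub>KG\<^esub> m) b" by (simp only: u one_eq_gr_of)
  also have "\<dots> = \<zero> \<oplus> ([card {i\<in>{..<m}. P b (int (k * i) + 1)}] \<cdot> \<one> \<ominus> [N] \<cdot> \<one>)"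
    by (simp only: gr_u_pow_apply[OF b] z N_def)
  also have "{i\<in>{..<m}. P b (int (k * i) + 1)} = {}" unfolding P using no by blast
  finally have "\<ominus> ([N] \<cdot> \<one>) = \<zero>" by (simp add: K.minus_eq)
  then have "[N] \<cdot> \<one> = \<zero>" by (metis K.add.inv_eq_1_iff K.add.nat_pow_closed K.one_closed)
  then show False using assms(1) N unfolding char_zero_def by blast
qed

end

end

theorem lemma2:
  fixes K :: "('k, 'm) ring_scheme" and G :: "('g, 'n) monoid_scheme"
    and a b :: 'g and k M :: nat
  assumes "domain K"
    and "group G"
    and "a \<in> carrier G"
    and "finite (generate G {a})"
    and "\<not> (generate G {a} \<lhd> G)"
    and "b \<in> carrier G - normalizer G (generate G {a})"
    and "M = (LEAST m. 2 \<le> m \<and> m \<le> group.ord G a \<and>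
                b \<in> normalizer G (generate G {a [^]\<^bsub>G\<^esub> m}))"
    and "1 \<le> k" and "k \<le> group.ord G a"
  shows "gr_u K G a b k \<in> Units (group_ring K G) \<and>
    (gcd k (group.ord G a) = 1 \<longrightarrow>
      group.ord (units_of (group_ring K G)) (gr_u K G a b k) = group.ord G a) \<and>
    (gcd k (group.ord G a) \<noteq> 1 \<longrightarrow>
      (gcd k M = 1 \<and> M \<noteq> group.ord G a \<longrightarrow>
        group.ord (units_of (group_ring K G)) (gr_u K G a b k) =
          group.ord G a div gcd k (group.ord G a)) \<and>
      (\<not> (gcd k M = 1 \<and> M \<noteq> group.ord G a) \<longrightarrow> char_zero K \<longrightarrow>
        group.ord (units_of (group_ring K G)) (gr_u K G a b k) = 0))"
proof -
  interpret K: domain K by fact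
  interpret G: group G by fact
  have b: "b \<in> carrier G" "b \<notin> normalizer G (generate G {a})" using assms(6) by auto
  have M: "2 \<le> M" "\<And>i::int. inv\<^bsub>G\<^esub> b \<otimes>\<^bsub>G\<^esub> a [^]\<^bsub>G\<^esub> i \<otimes>\<^bsub>G\<^esub> b \<in> generate G {a} \<longleftrightarrow> int M dvd i"
    using G.conj_int_pow_mem_generate_iff[OF assms(3,4) b] unfolding assms(7) by blast+
  have n: "G.ord a \<noteq> 0" using assms(8,9) by linarith
  interpret bicyclic_setting K G a b
    by unfold_locales (use assms(3) b n in simp_all)
  let ?u = "gr_u K G a b k" and ?U = "units_of (group_ring K G)" and ?n = "G.ord a"
  interpret U: group ?U by (rule KG.units_group)
  have u: "?u \<in> Units (group_ring K G)" by (rule gr_u_Units)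
  then have uU: "?u \<in> carrier ?U" by (simp add: units_of_carrier)
  have pow: "?u [^]\<^bsub>?U\<^esub> m = \<one>\<^bsub>?U\<^esub> \<longleftrightarrow> ?u [^]\<^bsub>group_ring K G\<^esub> m = \<one>\<^bsub>group_ring K G\<^esub>" for m :: nat
    by (simp only: KG.units_of_pow[OF u] units_of_one)
  \<comment> \<open>For \<open>k\<close> coprime to \<open>M\<close> the unit has the order of
    \<open>a\<close> to the power \<open>k\<close>; this serves case (i) and the finite part of case
    (ii).\<close>
  have fin: "U.ord ?u = ?n div gcd k ?n" if "coprime k M"
  proof -
    have "?u [^]\<^bsub>?U\<^esub> m = \<one>\<^bsub>?U\<^esub> \<longleftrightarrow> ?n div gcd k ?n dvd m" for m :: nat
    proof -
      have "?u [^]\<^bsub>?U\<^esub> m = \<one>\<^bsub>?U\<^esub> \<longleftrightarrow> a [^]\<^bsub>G\<^esub> (k * m) = \<one>\<^bsub>G\<^esub>"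
        unfolding pow using pow_eq_one_if_gr_u_pow_eq_one[OF M(2,1) K.one_not_zero, of k m]
          gr_u_pow_eq_one[OF M(2,1) that, of m] by blast
      also have "\<dots> \<longleftrightarrow> ?n dvd k * m" by (rule G.pow_eq_id[OF assms(3)])
      \<comment> \<open>Both sides say that \<open>?n\<close> divides \<open>m * gcd k ?n\<close>,
        which equals the gcd of \<open>m * k\<close> and \<open>m * ?n\<close>.\<close>
      also have "\<dots> \<longleftrightarrow> ?n div gcd k ?n dvd m"
        using n by (simp add: div_dvd_iff_mult gcd_mult_distrib_nat mult.commute)
      finally show ?thesis .
    qed
    then show ?thesis using U.ord_unique[OF uU] by blast
  qed
  have inf: "U.ord ?u = 0" if "\<not> coprime k M" "char_zero K"
    unfolding U.ord_eq_0[OF uU] pow using gr_u_pow_neq_one[OF M(2,1) that(2,1)] by blast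
  have "M dvd ?n" by (rule L_dvd_ord[OF M(2,1)])
  then have "coprime k M" if "gcd k ?n = 1"
    using coprime_divisors[OF dvd_refl \<open>M dvd ?n\<close>] that by (simp add: coprime_iff_gcd_eq_1)
  then have "U.ord ?u = ?n" if "gcd k ?n = 1"
    using fin that by simp
  \<comment> \<open>If \<open>gcd k ?n\<close> differs from 1, then \<open>M = ?n\<close> makes
    \<open>gcd k M\<close> differ from 1 too. The case split in (ii) is thus the split by
    coprimality of \<open>k\<close> and \<open>M\<close>, settled by \<open>fin\<close> and
    \<open>inf\<close>.\<close>
  then show ?thesis using u fin inf \<open>M dvd ?n\<close>
    by (metis coprime_iff_gcd_eq_1 gcd.commute)
qed

end
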